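(* Let $B>0$, let $(F,X)$ be a pair of random elements in $K_{kc}^B(\mathbb{R}^d)\times\mathcal{X}$ with $\mathcal{X}\subset\mathbb{R}^p$ compact, let $\mu=\mathbb{E}[X]$, and assume that $\Sigma=\mathbb{E}[(X-\mu)(X-\mu)']$ is invertible. For $x\in\mathbb{R}^p$ put $w(x,z)=1+(x-\mu)'\Sigma^{-1}(z-\mu)$, let $m_{\oplus,\Psi}(x)=\mathrm{argmin}_{h\in L^2(\mathbb{S}^{d-1})}\mathbb{E}[w(x,X)\|h-\Psi(F)\|_{2,\mathbb{S}^{d-1}}^2]=\mathbb{E}[w(x,X)\Psi(F)]$, and let $$\widetilde{m}_{\oplus,\Psi}(x)=\mathrm{argmin}_{h\in\Psi(K_{kc}^B(\mathbb{R}^d))}\|h-m_{\oplus,\Psi}(x)\|_{2,\mathbb{S}^{d-1}},\qquad m_\oplus(x)=\Psi^{-1}(\widetilde{m}_{\oplus,\Psi}(x)).$$ Then $m_\oplus(x)=\Psi^{-1}(\widetilde{m}_{\oplus,\Psi}(x))$ is the global Fréchet regression function, that is, it is the unique minimizer of $\mathbb{E}[w(x,X)d_{kc}^2(\nu,F)]$ over $\nu\in K_{kc}^B(\mathbb{R}^d)$. Additionally, if $\sup_{z\in\mathcal{X}}|w(x,z)|<\infty$ and $m_{\oplus,\Psi}(x)\in\Psi(K_{kc}(\mathbb{R}^d))$, then $m_\oplus(x)\subset\mathbb{E}[w(x,X)F]$, where $\mathbb{E}[w(x,X)F]$ denotes the Aumann mean of the random set $w(x,X)F$.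
   Context: $K_{kc}(\mathbb{R}^d)$ is the collection of nonempty compact convex subsets of $\mathbb{R}^d$, and $K_{kc}^B(\mathbb{R}^d)=\{F\in K_{kc}(\mathbb{R}^d):\sup_{f\in F}\|f\|\le B\}$. For $t\in\mathbb{R}$, $tF=\{tf:f\in F\}$. Support function: $s(p,F)=\sup_{f\in F}\langle p,f\rangle$ for $p\in\mathbb{S}^{d-1}=\{x\in\mathbb{R}^d:\|x\|=1\}$. $L^2(\mathbb{S}^{d-1})$ is the space of functions on $\mathbb{S}^{d-1}$ with $\|f\|_{2,\mathbb{S}^{d-1}}=(\int_{\mathbb{S}^{d-1}}f(p)^2dp)^{1/2}<\infty$, where $dp$ is the surface measure (counting measure on $\{-1,1\}$ when $d=1$). $\Psi(F)=s(\cdot,F)\in L^2(\mathbb{S}^{d-1})$, and $d_{kc}(F,G)=\|s(\cdot,F)-s(\cdot,G)\|_{2,\mathbb{S}^{d-1}}$ for $F,G\in K_{kc}(\mathbb{R}^d)$. Aumann mean: for a random compact set $G$, $\mathbb{E}[G]=\{\mathbb{E}[g]:g\in\mathcal{S}^1(G)\}$, where $\mathcal{S}^1(G)$ is the set of measurable selections $g$ of $G$ (random vectors with $g\in G$) such that $\mathbb{E}\|g\|<\infty$.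
   Formalization: The final inclusion is false as printed (d=p=1, B=1, X=±1 uniform, F={X}, x=2). It is proved for m_{⊕,Ψ}(x) in Ψ(K_kc^B(R^d)); if m_{⊕,Ψ}(x) is only in Ψ(K_kc(R^d)), the set shown to lie in E[w(x,X)F] is Ψ^{-1}(m_{⊕,Ψ}(x)) instead of m_⊕(x). *)

theory Defs
  imports "HOL-Probability.Probability"
begin

definition Kkc :: "'a::euclidean_space set set" where
  "Kkc = {F. F \<noteq> {} \<and> compact F \<and> convex F}"

definition KkcB :: "real \<Rightarrow> 'a::euclidean_space set set" where
  "KkcB B = {F \<in> Kkc. (SUP f\<in>F. norm f) \<le> B}"

definition support_fun :: "'a::euclidean_space \<Rightarrow> 'a set \<Rightarrow> real" where
  "support_fun p F = (SUP f\<in>F. p \<bullet> f)"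

(* Surface measure through polar coordinates: the measure of a Borel subset A of the unit sphere
   is d times the Lebesgue measure of the truncated cone {x. 0 < norm x \<le> 1 \<and> x / norm x \<in> A}.
   For d = 1 this is counting measure on {-1, 1}, see sphere_measure_real below. *)
definition sphere_measure :: "'a::euclidean_space measure" where
  "sphere_measure =
     scale_measure (of_nat DIM('a))
       (distr (restrict_space lborel (cball 0 1 - {0}))
              (restrict_space borel (sphere 0 1))
              (\<lambda>x. x /\<^sub>R norm x))"

(* Elements of L2 are represented by functions; equality in L2 is equality almost everywhere
   with respect to sphere_measure. *)
definition L2_sphere :: "('a::euclidean_space \<Rightarrow> real) set" where
  "L2_sphere = {h \<in> borel_measurable sphere_measure. integrable sphere_measure (\<lambda>p. (h p)\<^sup>2)}"

definition norm_L2 :: "('a::euclidean_space \<Rightarrow> real) \<Rightarrow> real" where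
  "norm_L2 h = sqrt (LINT p|sphere_measure. (h p)\<^sup>2)"

definition Psi :: "'a::euclidean_space set \<Rightarrow> 'a \<Rightarrow> real" where
  "Psi F = (\<lambda>p\<in>sphere 0 1. support_fun p F)"

definition d_kc :: "'a::euclidean_space set \<Rightarrow> 'a set \<Rightarrow> real" where
  "d_kc F G = norm_L2 (\<lambda>p. Psi F p - Psi G p)"

definition borel_KkcB :: "real \<Rightarrow> 'a::euclidean_space set measure" where
  "borel_KkcB B = sigma (KkcB B) {U. openin (Metric_space.mtopology (KkcB B) d_kc) U}"

definition mean_vec :: "'w measure \<Rightarrow> ('w \<Rightarrow> real^'p) \<Rightarrow> real^'p" where
  "mean_vec M X = (LINT \<omega>|M. X \<omega>)"

definition cov_mat :: "'w measure \<Rightarrow> ('w \<Rightarrow> real^'p) \<Rightarrow> real^'p^'p" where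
  "cov_mat M X =
     (\<chi> i j. LINT \<omega>|M. (X \<omega> - mean_vec M X) $ i * (X \<omega> - mean_vec M X) $ j)"

definition weight :: "'w measure \<Rightarrow> ('w \<Rightarrow> real^'p) \<Rightarrow> real^'p \<Rightarrow> real^'p \<Rightarrow> real" where
  "weight M X x z =
     1 + (x - mean_vec M X) \<bullet> (matrix_inv (cov_mat M X) *v (z - mean_vec M X))"

definition L2_risk ::
  "'w measure \<Rightarrow> ('w \<Rightarrow> 'a::euclidean_space set) \<Rightarrow> ('w \<Rightarrow> real^'p) \<Rightarrow> real^'p \<Rightarrow> ('a \<Rightarrow> real) \<Rightarrow> real"
  where
  "L2_risk M F X x h =
     (LINT \<omega>|M. weight M X x (X \<omega>) * (norm_L2 (\<lambda>p. h p - Psi (F \<omega>) p))\<^sup>2)"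

(* The L2-valued expectation of weight * Psi(F), evaluated point by point. *)
definition L2_mean ::
  "'w measure \<Rightarrow> ('w \<Rightarrow> 'a::euclidean_space set) \<Rightarrow> ('w \<Rightarrow> real^'p) \<Rightarrow> real^'p \<Rightarrow> 'a \<Rightarrow> real"
  where
  "L2_mean M F X x = (\<lambda>p\<in>sphere 0 1. LINT \<omega>|M. weight M X x (X \<omega>) * Psi (F \<omega>) p)"

(* A representative of the almost-everywhere class of minimizers; everything below depends on it
   only through its class. *)
definition m_Psi ::
  "'w measure \<Rightarrow> ('w \<Rightarrow> 'a::euclidean_space set) \<Rightarrow> ('w \<Rightarrow> real^'p) \<Rightarrow> real^'p \<Rightarrow> 'a \<Rightarrow> real"
  where
  "m_Psi M F X x = arg_min_on (L2_risk M F X x) L2_sphere"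

definition m_tilde ::
  "'w measure \<Rightarrow> real \<Rightarrow> ('w \<Rightarrow> 'a::euclidean_space set) \<Rightarrow> ('w \<Rightarrow> real^'p) \<Rightarrow> real^'p \<Rightarrow> 'a \<Rightarrow> real"
  where
  "m_tilde M B F X x = arg_min_on (\<lambda>h. norm_L2 (\<lambda>p. h p - m_Psi M F X x p)) (Psi ` KkcB B)"

definition m_plus ::
  "'w measure \<Rightarrow> real \<Rightarrow> ('w \<Rightarrow> 'a::euclidean_space set) \<Rightarrow> ('w \<Rightarrow> real^'p) \<Rightarrow> real^'p \<Rightarrow> 'a set"
  where
  "m_plus M B F X x = inv_into (KkcB B) Psi (m_tilde M B F X x)"

definition aumann_mean :: "'w measure \<Rightarrow> ('w \<Rightarrow> 'a::euclidean_space set) \<Rightarrow> 'a set" where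
  "aumann_mean M G =
     {(LINT \<omega>|M. g \<omega>) | g. integrable M g \<and> (\<forall>\<omega>\<in>space M. g \<omega> \<in> G \<omega>)}"

lemma normalize_measurable_sphere [measurable]:
  "(\<lambda>x::'a::euclidean_space. x /\<^sub>R norm x)
     \<in> restrict_space lborel (cball 0 1 - {0}) \<rightarrow>\<^sub>M restrict_space borel (sphere 0 1)"
proof (rule measurable_restrict_space2)
  show "(\<lambda>x::'a. x /\<^sub>R norm x) \<in> space (restrict_space lborel (cball 0 1 - {0})) \<rightarrow> sphere 0 1"
    by (auto simp: space_restrict_space)
  have "(\<lambda>x::'a. x /\<^sub>R norm x) \<in> borel_measurable lborel"
    by measurable
  then show "(\<lambda>x::'a. x /\<^sub>R norm x) \<in> borel_measurable (restrict_space lborel (cball 0 1 - {0}))"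
    by (rule measurable_restrict_space1)
qed

lemma space_sphere_measure: "space (sphere_measure :: 'a::euclidean_space measure) = sphere 0 1"
  by (simp add: sphere_measure_def space_scale_measure space_restrict_space)

lemma sets_sphere_measure:
  "sets (sphere_measure :: 'a::euclidean_space measure) = sets (restrict_space borel (sphere 0 1))"
  by (simp add: sphere_measure_def)

lemma emeasure_sphere_measure:
  assumes "A \<in> sets (sphere_measure :: 'a::euclidean_space measure)"
  shows "emeasure sphere_measure A =
    of_nat DIM('a) * emeasure lborel {x::'a. 0 < norm x \<and> norm x \<le> 1 \<and> x /\<^sub>R norm x \<in> A}"
proof -
  have A: "A \<in> sets (restrict_space borel (sphere (0::'a) 1))"
    using assms by (simp add: sets_sphere_measure)
  have eq: "(\<lambda>x::'a. x /\<^sub>R norm x) -` A \<inter> space (restrict_space lborel (cball 0 1 - {0}))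
    = {x. 0 < norm x \<and> norm x \<le> 1 \<and> x /\<^sub>R norm x \<in> A}"
    by (auto simp: space_restrict_space)
  show ?thesis
    unfolding sphere_measure_def emeasure_scale_measure emeasure_distr[OF normalize_measurable_sphere A] eq
    by (subst emeasure_restrict_space) auto
qed

lemma sphere_measure_real: "(sphere_measure :: real measure) = count_space {-1, 1}"
proof (rule measure_eqI)
  have sph: "sphere (0::real) 1 = {-1, 1}"
    by (auto simp: dist_real_def)
  have fin: "A \<in> sets (restrict_space borel {-1, 1 :: real}) \<longleftrightarrow> A \<subseteq> {-1, 1}" for A
    by (subst sets_restrict_space_iff) (auto intro: borel_closed finite_imp_closed finite_subset)
  show "sets (sphere_measure :: real measure) = sets (count_space {-1, 1})"
    unfolding sets_sphere_measure sph using fin by auto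
  fix A assume A: "A \<in> sets (sphere_measure :: real measure)"
  then have "A \<subseteq> {-1, 1}" unfolding sets_sphere_measure sph fin .
  then consider "A = {}" | "A = {-1}" | "A = {1}" | "A = {-1, 1}" by blast
  then have "emeasure lborel {x::real. 0 < norm x \<and> norm x \<le> 1 \<and> x /\<^sub>R norm x \<in> A} = card A"
  proof cases
    case 1 then show ?thesis by simp
  next
    case 2
    then have "{x::real. 0 < norm x \<and> norm x \<le> 1 \<and> x /\<^sub>R norm x \<in> A} = {-1..<0}"
      by (auto simp: field_simps abs_if split: if_splits)
    with 2 show ?thesis by simp
  next
    case 3
    then have "{x::real. 0 < norm x \<and> norm x \<le> 1 \<and> x /\<^sub>R norm x \<in> A} = {0<..1}"
      by (auto simp: field_simps abs_if split: if_splits)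
    with 3 show ?thesis by simp
  next
    case 4
    then have "{x::real. 0 < norm x \<and> norm x \<le> 1 \<and> x /\<^sub>R norm x \<in> A} = {-1..1} - {0}"
      by (auto simp: field_simps abs_if split: if_splits)
    moreover have "emeasure lborel ({-1..1} - {0::real}) = emeasure lborel {-1..1::real}"
      by (subst emeasure_Diff) auto
    ultimately show ?thesis using 4 by simp
  qed
  with \<open>A \<subseteq> {-1, 1}\<close> show "emeasure sphere_measure A = emeasure (count_space {-1, 1}) A"
    by (simp add: emeasure_sphere_measure[OF A] emeasure_count_space_finite finite_subset)
qed

end

theory Submission
  imports Defs
begin

text \<open>
Sending a compact convex set to its support function turns the regression problem into one about
the Hilbert space \<open>L\<^sup>2\<close> of the sphere. The weight \<open>w\<close> may be negative, but its expectation is \<open>1\<close>, so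
expanding the square and exchanging the order of integration gives
\<open>E [w * \<parallel>h - s(F)\<parallel>\<^sup>2] = \<parallel>h - m\<parallel>\<^sup>2 + const\<close> with \<open>m = E [w * s(F)]\<close>
(\<open>weighted_risk_decomposition\<close>). Minimizing the risk over all of \<open>L\<^sup>2\<close> therefore gives \<open>m\<close>, and minimizing
it over support functions of sets in the ball of radius \<open>B\<close> is metric projection of \<open>m\<close> onto a
convex family of functions.

The projection exists and is unique (\<open>closed_convex_projection\<close>). By the parallelogram law,
minimizing sequences are Cauchy in \<open>L\<^sup>2\<close>. Support functions of sets in the ball are \<open>B\<close>-Lipschitz, and
for Lipschitz functions smallness in \<open>L\<^sup>2\<close> forces uniform smallness, because spherical caps of a given
radius have measure bounded below (\<open>lipschitz_small_L2_imp_small\<close>). Hence the support functions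
converge pointwise, and the limit is again a support function: maximizers of a linear functional on
the approximating sets have a cluster point that maximizes it on the limit set
(\<open>KkcB_complete\<close>). The comparison of \<open>L\<^sup>2\<close> and uniform distance also makes evaluations of the support
function and nearest-point maps continuous for \<open>d_kc\<close>, hence measurable.

For the inclusion in the Aumann mean, suppose that \<open>m\<close> is the support function of \<open>G\<close>. The selection
that takes \<open>w\<close> times the point of \<open>F\<close> nearest to \<open>t *\<^sub>R p\<close>, with \<open>t\<close> large, has a mean whose product
with \<open>p\<close> is almost at least \<open>E [w * s(p, F)]\<close>: where \<open>w\<close> is nonnegative the nearest point nearly
maximizes the product with \<open>p\<close>, and where \<open>w\<close> is negative every point of \<open>F\<close> will do. So no closed
half-space containing the Aumann mean misses a point of \<open>G\<close>. The Aumann mean is convex, and it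
is closed because selections of nearly minimal \<open>L\<^sup>2\<close> norm, among those whose means approach a given
point, form a Cauchy sequence (\<open>aumann_mean_closed\<close>). Separation yields the inclusion.
\<close>

section \<open>Near-minimizers of uniformly convex functionals\<close>

text \<open>
The usual proof that minimizing sequences are Cauchy, separated from any particular Hilbert space:
\<open>D\<close> plays the squared distance, and \<open>mid\<close> is what the parallelogram law gives for midpoints in a
convex set. Two near-minimizers that are far apart would have a midpoint with value below the
infimum. The sets may shrink with \<open>n\<close>; then the infima increase to a limit, which is what
the bound \<open>C\<close> secures.
\<close>
lemma near_minimizers_Cauchy:
  fixes S :: "nat \<Rightarrow> 'a set" and Q :: "'a \<Rightarrow> real" and D :: "'a \<Rightarrow> 'a \<Rightarrow> real"
  assumes dec: "\<And>m n. m \<le> n \<Longrightarrow> S n \<subseteq> S m"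
    and ne: "\<And>n. S n \<noteq> {}"
    and Q0: "\<And>x. x \<in> S 0 \<Longrightarrow> 0 \<le> Q x"
    and QC: "\<And>x. x \<in> S 0 \<Longrightarrow> Q x \<le> C"
    and mid: "\<And>n x y. x \<in> S n \<Longrightarrow> y \<in> S n \<Longrightarrow> \<exists>z\<in>S n. Q z \<le> (Q x + Q y) / 2 - D x y / 4"
  obtains x where "\<And>n. x n \<in> S n"
    and "\<And>n y. y \<in> S n \<Longrightarrow> Q (x n) \<le> Q y + 1 / real (Suc n)"
    and "\<And>e. e > 0 \<Longrightarrow> \<exists>N. \<forall>m\<ge>N. \<forall>n\<ge>N. D (x m) (x n) < e"
proof -
  define I where "I n = (INF y\<in>S n. Q y)" for n
  have S0: "S n \<subseteq> S 0" for n
    using dec[of 0 n] by simp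
  have bdd: "bdd_below (Q ` S n)" for n
    using Q0 S0 by (intro bdd_belowI[of _ 0]) auto
  have I_le: "I n \<le> Q y" if "y \<in> S n" for n y
    unfolding I_def using bdd that by (rule cINF_lower)
  have "\<exists>x\<in>S n. Q x < I n + 1 / real (Suc n)" for n
  proof -
    have "Inf (Q ` S n) < I n + 1 / real (Suc n)"
      by (simp add: I_def)
    then show ?thesis
      using cInf_less_iff[OF _ bdd, of n] ne by auto
  qed
  then obtain x where xS: "\<And>n. x n \<in> S n" and xI: "\<And>n. Q (x n) < I n + 1 / real (Suc n)"
    by metis
  have mono: "I m \<le> I n" if "m \<le> n" for m n
    unfolding I_def using dec[OF that] by (intro cINF_superset_mono bdd ne) auto
  have "I n \<le> C" for n
    using I_le[OF xS] QC xS S0 by (meson order_trans subsetD)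
  then obtain J where J: "I \<longlonglongrightarrow> J" and IJ: "\<And>n. I n \<le> J"
    using incseq_convergent[of I C] mono by (metis incseq_def)
  have "\<exists>N. \<forall>m\<ge>N. \<forall>n\<ge>N. D (x m) (x n) < e" if e: "e > 0" for e
  proof -
    have "(\<lambda>n. 4 * (J - I n + 1 / real (Suc n))) \<longlonglongrightarrow> 4 * (J - J + 0)"
      by (intro tendsto_intros J LIMSEQ_Suc[OF lim_1_over_n])
    then have "\<forall>\<^sub>F n in sequentially. 4 * (J - I n + 1 / real (Suc n)) < e"
      using e order_tendstoD(2) by fastforce
    then obtain N where N: "4 * (J - I N + 1 / real (Suc N)) < e"
      using eventually_happens'[OF sequentially_bot] by blast
    have "D (x m) (x n) < e" if mn: "m \<ge> N" "n \<ge> N" for m n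
    proof -
      obtain z where z: "z \<in> S N" "Q z \<le> (Q (x m) + Q (x n)) / 2 - D (x m) (x n) / 4"
        using mid[of "x m" N "x n"] xS dec mn by blast
      have frac: "1 / real (Suc k) \<le> 1 / real (Suc N)" if "k \<ge> N" for k
        using that by (simp add: frac_le)
      have Qk: "Q (x k) \<le> J + 1 / real (Suc N)" if "k \<ge> N" for k
        using xI[of k] IJ[of k] frac[OF that] by linarith
      have "D (x m) (x n) \<le> 2 * (Q (x m) + Q (x n)) - 4 * I N"
        using z(2) I_le[OF z(1)] by linarith
      also have "\<dots> \<le> 4 * (J - I N + 1 / real (Suc N))"
        using Qk[OF mn(1)] Qk[OF mn(2)] by argo
      finally show ?thesis using N by linarith
    qed
    then show ?thesis by blast
  qed
  moreover have "Q (x n) \<le> Q y + 1 / real (Suc n)" if "y \<in> S n" for n y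
    using I_le[OF that] xI[of n] by linarith
  ultimately show ?thesis using that xS by blast
qed

section \<open>Support functions of compact convex sets\<close>

lemma support_fun_upper: "compact F \<Longrightarrow> f \<in> F \<Longrightarrow> p \<bullet> f \<le> support_fun p F"
  unfolding support_fun_def
  by (intro cSUP_upper bounded_imp_bdd_above compact_imp_bounded compact_continuous_image
      continuous_intros)

lemma support_fun_attained:
  assumes "compact F" "F \<noteq> {}"
  obtains f where "f \<in> F" "support_fun p F = p \<bullet> f"
proof -
  have "continuous_on F (\<lambda>f. p \<bullet> f)" by (intro continuous_intros)
  then obtain f where f: "f \<in> F" "\<forall>g\<in>F. p \<bullet> g \<le> p \<bullet> f"
    using continuous_attains_sup assms by blast
  then have "support_fun p F \<le> p \<bullet> f"
    unfolding support_fun_def using assms by (intro cSUP_least) auto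
  with support_fun_upper[OF assms(1) f(1), of p] have "support_fun p F = p \<bullet> f" by simp
  with f(1) that show ?thesis by blast
qed

lemma Kkc_D: "F \<in> Kkc \<Longrightarrow> F \<noteq> {}" "F \<in> Kkc \<Longrightarrow> compact F" "F \<in> Kkc \<Longrightarrow> convex F"
    "F \<in> Kkc \<Longrightarrow> closed F"
  by (auto simp: Kkc_def compact_imp_closed)

lemma KkcB_iff: "F \<in> KkcB B \<longleftrightarrow> F \<in> Kkc \<and> (\<forall>f\<in>F. norm f \<le> B)"
proof (cases "F \<in> Kkc")
  case True
  have "bdd_above (norm ` F)"
    using Kkc_D[OF True]
    by (intro bounded_imp_bdd_above compact_imp_bounded compact_continuous_image continuous_intros)
  then show ?thesis
    using True Kkc_D(1)[OF True] by (auto simp: KkcB_def cSUP_le_iff)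
qed (auto simp: KkcB_def)

lemma KkcB_D: "F \<in> KkcB B \<Longrightarrow> F \<noteq> {}" "F \<in> KkcB B \<Longrightarrow> compact F" "F \<in> KkcB B \<Longrightarrow> convex F"
    "F \<in> KkcB B \<Longrightarrow> closed F" "F \<in> KkcB B \<Longrightarrow> f \<in> F \<Longrightarrow> norm f \<le> B"
  by (auto simp: KkcB_iff Kkc_D)

lemma KkcB_nonneg: "F \<in> KkcB B \<Longrightarrow> 0 \<le> B"
  using KkcB_D(1,5)[of F B] norm_ge_zero order_trans by (metis ex_in_conv)

lemma Kkc_in_KkcB:
  assumes "F \<in> Kkc"
  obtains B where "F \<in> KkcB B"
  using compact_imp_bounded[OF Kkc_D(2)[OF assms]] assms unfolding bounded_iff
  by (auto simp: KkcB_iff)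

lemma support_fun_scale:
  assumes "F \<in> Kkc" "0 \<le> c"
  shows "support_fun (c *\<^sub>R p) F = c * support_fun p F"
proof -
  obtain f where f: "f \<in> F" "support_fun p F = p \<bullet> f"
    using support_fun_attained Kkc_D assms(1) by metis
  obtain g where g: "g \<in> F" "support_fun (c *\<^sub>R p) F = (c *\<^sub>R p) \<bullet> g"
    using support_fun_attained Kkc_D assms(1) by metis
  show ?thesis
    using support_fun_upper[OF Kkc_D(2)[OF assms(1)] f(1), of "c *\<^sub>R p"] f g
      mult_left_mono[OF support_fun_upper[OF Kkc_D(2)[OF assms(1)] g(1), of p] assms(2)]
    by auto
qed

lemma support_fun_bound:
  assumes "F \<in> KkcB B"
  shows "\<bar>support_fun p F\<bar> \<le> B * norm p"
proof -
  obtain f where f: "f \<in> F" "support_fun p F = p \<bullet> f"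
    using support_fun_attained KkcB_D assms by metis
  have "\<bar>p \<bullet> f\<bar> \<le> norm p * norm f" by (rule Cauchy_Schwarz_ineq2)
  also have "\<dots> \<le> norm p * B"
    using KkcB_D(5)[OF assms f(1)] by (intro mult_left_mono) auto
  finally show ?thesis using f by (simp add: mult.commute)
qed

lemma support_fun_lipschitz:
  assumes "F \<in> KkcB B"
  shows "B-lipschitz_on UNIV (\<lambda>p. support_fun p F)"
proof (rule lipschitz_onI)
  have le: "support_fun p F - support_fun q F \<le> B * norm (p - q)" for p q
  proof -
    obtain f where f: "f \<in> F" "support_fun p F = p \<bullet> f"
      using support_fun_attained KkcB_D assms by metis
    have "p \<bullet> f - q \<bullet> f \<le> norm (p - q) * norm f"
      using norm_cauchy_schwarz[of "p - q" f] by (simp add: inner_diff_left)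
    also have "\<dots> \<le> norm (p - q) * B"
      using KkcB_D(5)[OF assms f(1)] by (intro mult_left_mono) auto
    finally show ?thesis
      using f support_fun_upper[OF KkcB_D(2)[OF assms] f(1), of q] by (simp add: mult.commute)
  qed
  fix p q :: 'a
  show "dist (support_fun p F) (support_fun q F) \<le> B * dist p q"
    using le[of p q] le[of q p] by (simp add: dist_norm norm_minus_commute abs_le_iff)
qed (rule KkcB_nonneg[OF assms])

text \<open>
A closed convex set is the intersection of the closed half-spaces containing it; unit normals
suffice because the normal of a separating hyperplane can be rescaled: for a nonempty set it is not
zero.
\<close>
lemma mem_closed_convex_by_halfspaces:
  fixes C :: "'a::euclidean_space set"
  assumes "closed C" "convex C" "C \<noteq> {}"
    and le: "\<And>p c. norm p = 1 \<Longrightarrow> (\<And>y. y \<in> C \<Longrightarrow> p \<bullet> y \<le> c) \<Longrightarrow> p \<bullet> g \<le> c"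
  shows "g \<in> C"
proof (rule ccontr)
  assume "g \<notin> C"
  then obtain a b where ab: "a \<bullet> g < b" "\<And>y. y \<in> C \<Longrightarrow> b < a \<bullet> y"
    using separating_hyperplane_closed_point assms(1,2) by metis
  obtain y0 where "y0 \<in> C" using assms(3) by blast
  with ab have a: "norm a > 0" by force
  define p where "p = - (a /\<^sub>R norm a)"
  have p: "p \<bullet> y = - (a \<bullet> y / norm a)" for y
    by (simp add: p_def divide_inverse)
  have "p \<bullet> g \<le> - (b / norm a)"
  proof (rule le)
    show "norm p = 1" using a by (simp add: p_def)
    show "p \<bullet> y \<le> - (b / norm a)" if "y \<in> C" for y
      using ab(2)[OF that] a by (simp add: p divide_right_mono)
  qed
  moreover have "p \<bullet> g > - (b / norm a)"
    using ab(1) a by (simp add: p divide_strict_right_mono)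
  ultimately show False by simp
qed

lemma Kkc_subset_by_support:
  assumes "F \<in> Kkc" "G \<in> Kkc" "\<And>p. p \<in> sphere 0 1 \<Longrightarrow> support_fun p F \<le> support_fun p G"
  shows "F \<subseteq> G"
proof
  fix f assume f: "f \<in> F"
  show "f \<in> G"
  proof (rule mem_closed_convex_by_halfspaces[of G])
    fix p :: 'a and c assume p: "norm p = 1" and c: "\<And>y. y \<in> G \<Longrightarrow> p \<bullet> y \<le> c"
    have "p \<bullet> f \<le> support_fun p G"
      using support_fun_upper[OF Kkc_D(2)[OF assms(1)] f, of p] assms(3)[of p] p by simp
    also have "\<dots> \<le> c"
      unfolding support_fun_def using Kkc_D(1)[OF assms(2)] c by (rule cSUP_least)
    finally show "p \<bullet> f \<le> c" .
  qed (use Kkc_D assms in auto)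
qed

lemma Psi_apply [simp]: "p \<in> sphere 0 1 \<Longrightarrow> Psi F p = support_fun p F"
  by (simp add: Psi_def)

lemma Psi_inj:
  assumes "F \<in> Kkc" "G \<in> Kkc" "\<And>p. p \<in> sphere 0 1 \<Longrightarrow> Psi F p = Psi G p"
  shows "F = G"
  using Kkc_subset_by_support[OF assms(1,2)] Kkc_subset_by_support[OF assms(2,1)] assms(3) by auto

lemma inj_on_Psi: "inj_on Psi (KkcB B)"
  by (rule inj_onI, rule Psi_inj) (auto simp: KkcB_iff)

text \<open>
The witness is the Minkowski average. It makes the family of support functions midpoint-convex,
as the projection argument requires.
\<close>
lemma KkcB_midpoint:
  fixes F G :: "'a::euclidean_space set"
  assumes "F \<in> KkcB B" "G \<in> KkcB B"
  obtains H where "H \<in> KkcB B"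
    "\<And>p. support_fun p H = (support_fun p F + support_fun p G) / 2"
proof -
  define H where "H = (\<lambda>(f, g). (1/2) *\<^sub>R (f + g)) ` (F \<times> G)"
  have lin: "linear (\<lambda>(f, g). (1/2) *\<^sub>R (f + g :: 'a))"
    by (rule linearI) (auto simp: scaleR_add_right algebra_simps)
  have "H \<in> Kkc"
    unfolding Kkc_def H_def
    using KkcB_D[OF assms(1)] KkcB_D[OF assms(2)]
    by (auto simp: case_prod_unfold intro!: compact_continuous_image compact_Times continuous_intros
        convex_linear_image[OF lin[unfolded case_prod_unfold]] convex_Times)
  moreover have "norm ((1/2) *\<^sub>R (f + g)) \<le> B" if "f \<in> F" "g \<in> G" for f g
    using norm_triangle_ineq[of f g] KkcB_D(5)[OF assms(1) that(1)] KkcB_D(5)[OF assms(2) that(2)]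
    by simp
  ultimately have H: "H \<in> KkcB B"
    by (auto simp: KkcB_iff H_def)
  moreover have "support_fun p H = (support_fun p F + support_fun p G) / 2" for p
  proof (rule antisym)
    obtain h where "h \<in> H" "support_fun p H = p \<bullet> h"
      using support_fun_attained KkcB_D[OF H] by metis
    then obtain f g where "f \<in> F" "g \<in> G" "support_fun p H = (p \<bullet> f + p \<bullet> g) / 2"
      by (auto simp: H_def inner_add_right)
    then show "support_fun p H \<le> (support_fun p F + support_fun p G) / 2"
      using support_fun_upper KkcB_D(2) assms by (metis add_mono divide_right_mono zero_le_numeral)
    obtain f g where fg: "f \<in> F" "support_fun p F = p \<bullet> f" "g \<in> G" "support_fun p G = p \<bullet> g"
      using support_fun_attained KkcB_D assms by metis
    then have "(1/2) *\<^sub>R (f + g) \<in> H" by (auto simp: H_def)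
    from support_fun_upper[OF KkcB_D(2)[OF H] this, of p] fg
    show "(support_fun p F + support_fun p G) / 2 \<le> support_fun p H"
      by (simp add: inner_add_right)
  qed
  ultimately show ?thesis using that by blast
qed

text \<open>
The limit set is cut out by the half-spaces that the limit function \<open>u\<close> prescribes. That \<open>u\<close> is its
support function, and not merely an upper bound for it, follows by compactness: points maximizing
\<open>p\<close> on the approximating sets stay in a ball, and a cluster point lies in the limit set with
product \<open>u p\<close>.
\<close>
lemma KkcB_complete:
  fixes F :: "nat \<Rightarrow> 'a::euclidean_space set"
  assumes F: "\<And>n. F n \<in> KkcB B"
    and conv: "\<And>p. p \<in> sphere 0 1 \<Longrightarrow> convergent (\<lambda>n. support_fun p (F n))"
  obtains G where "G \<in> KkcB B" "\<And>p. (\<lambda>n. support_fun p (F n)) \<longlonglongrightarrow> support_fun p G"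
proof -
  have FK: "F n \<in> Kkc" for n using F by (simp add: KkcB_iff)
  \<comment> \<open>Homogeneity extends convergence from the sphere to all \<open>p\<close>.\<close>
  have "convergent (\<lambda>n. support_fun p (F n))" for p
  proof (cases "p = 0")
    case True
    then show ?thesis using support_fun_scale[OF FK, of 0 p] by (simp add: convergent_const)
  next
    case False
    then have "support_fun p (F n) = norm p * support_fun (p /\<^sub>R norm p) (F n)" for n
      using support_fun_scale[OF FK, of "norm p" "p /\<^sub>R norm p" n] by simp
    moreover have "convergent (\<lambda>n. norm p * support_fun (p /\<^sub>R norm p) (F n))"
      using False conv[of "p /\<^sub>R norm p"] by (intro convergent_mult convergent_const) auto
    ultimately show ?thesis by simp
  qed
  then obtain u where u: "\<And>p. (\<lambda>n. support_fun p (F n)) \<longlonglongrightarrow> u p"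
    unfolding convergent_def by metis
  define G where "G = {f. \<forall>p. p \<bullet> f \<le> u p}"
  have G_eq: "G = (\<Inter>p. {f. p \<bullet> f \<le> u p})" by (auto simp: G_def)
  have cl: "closed G" and cv: "convex G"
    unfolding G_eq by (auto intro!: closed_INT convex_INT closed_halfspace_le convex_halfspace_le)
  have nB: "norm f \<le> B" if "f \<in> G" for f
  proof -
    have "norm f * norm f = f \<bullet> f" by (simp add: norm_eq_sqrt_inner)
    also have "\<dots> \<le> u f" using that by (auto simp: G_def)
    also have "u f \<le> B * norm f"
      using LIMSEQ_le_const2[OF u, of f "B * norm f"] support_fun_bound[OF F, of f]
      by (meson abs_le_D1)
    finally show ?thesis
      by (cases "f = 0") (use KkcB_nonneg[OF F] in auto)
  qed
  have att: "\<exists>f\<in>G. p \<bullet> f = u p" for p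
  proof -
    have "\<exists>f. f \<in> F n \<and> support_fun p (F n) = p \<bullet> f" for n
      using support_fun_attained KkcB_D F by metis
    then obtain f where f: "\<And>n. f n \<in> F n" "\<And>n. support_fun p (F n) = p \<bullet> f n"
      by metis
    have "\<And>n. f n \<in> cball 0 B"
      using KkcB_D(5)[OF F f(1)] by simp
    then obtain l r where r: "strict_mono r" "(f \<circ> r) \<longlonglongrightarrow> l"
      using compact_cball[of "0::'a" B] unfolding compact_def by metis
    have lim: "(\<lambda>n. q \<bullet> f (r n)) \<longlonglongrightarrow> q \<bullet> l" for q
      using r(2) by (auto simp: o_def intro: tendsto_intros)
    have ur: "(\<lambda>n. support_fun q (F (r n))) \<longlonglongrightarrow> u q" for q
      using LIMSEQ_subseq_LIMSEQ[OF u r(1)] by (simp add: o_def)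
    have "l \<in> G" unfolding G_def
      using LIMSEQ_le[OF lim ur] support_fun_upper[OF KkcB_D(2)[OF F] f(1)] by blast
    moreover have "p \<bullet> l = u p"
      using LIMSEQ_unique[OF lim[of p]] ur[of p] f(2) by simp
    ultimately show ?thesis by blast
  qed
  have cp: "compact G"
    unfolding compact_eq_bounded_closed bounded_iff using nB cl by blast
  have GK: "G \<in> KkcB B"
    using att nB cp cv by (auto simp: KkcB_iff Kkc_def)
  have "support_fun p G = u p" for p
  proof (rule antisym)
    show "support_fun p G \<le> u p"
      unfolding support_fun_def using att by (intro cSUP_least) (auto simp: G_def)
    show "u p \<le> support_fun p G"
      using att[of p] support_fun_upper[OF cp, of _ p] by metis
  qed
  with GK u that show ?thesis by simp
qed

section \<open>Square-integrable and Lipschitz functions on the sphere\<close>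

lemma finite_sphere_measure: "finite_measure (sphere_measure :: 'a::euclidean_space measure)"
proof (rule finite_measureI)
  have "emeasure (sphere_measure :: 'a measure) (space sphere_measure)
      \<le> of_nat DIM('a) * emeasure lborel (cball (0::'a) 1)"
    by (subst emeasure_sphere_measure) (auto intro!: mult_left_mono emeasure_mono)
  also have "\<dots> < \<infinity>"
    using emeasure_lborel_cball_finite[of "0::'a" 1] by (simp add: ennreal_mult_less_top of_nat_less_top)
  finally show "emeasure (sphere_measure :: 'a measure) (space sphere_measure) \<noteq> \<infinity>" by simp
qed

interpretation sphere: finite_measure "sphere_measure :: 'a::euclidean_space measure"
  by (rule finite_sphere_measure)

text \<open>
The cone over the cap contains a ball of radius \<open>\<rho>\<close> centred at \<open>p /\<^sub>R 2\<close>: there the norm is at least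
\<open>1/4\<close> and \<open>x\<close> is within \<open>2 * \<rho>\<close> of \<open>norm x *\<^sub>R p\<close>, so normalizing moves it within \<open>8 * \<rho>\<close> of \<open>p\<close>. The volume
of that ball is the same for every \<open>p\<close>; this uniformity is the point of the bound.
\<close>
lemma sphere_cap_measure_ge:
  fixes p :: "'a::euclidean_space"
  assumes p: "p \<in> sphere 0 1" and "r > 0" and \<rho>: "\<rho> = min (1/4) (r/8)"
  shows "unit_ball_vol (DIM('a)) * \<rho> ^ DIM('a) \<le> measure sphere_measure (sphere 0 1 \<inter> cball p r)"
proof -
  let ?cap = "sphere 0 1 \<inter> cball p r"
  have \<rho>0: "0 < \<rho>" "\<rho> \<le> 1/4" "8 * \<rho> \<le> r" using assms by auto
  have cap: "?cap \<in> sets (sphere_measure :: 'a measure)"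
    unfolding sets_sphere_measure by (auto simp: sets_restrict_space)
  have sub: "ball (p /\<^sub>R 2) \<rho> \<subseteq> {x. 0 < norm x \<and> norm x \<le> 1 \<and> x /\<^sub>R norm x \<in> ?cap}"
  proof
    fix x assume "x \<in> ball (p /\<^sub>R 2) \<rho>"
    then have x: "norm (x - p /\<^sub>R 2) < \<rho>" by (simp add: dist_norm norm_minus_commute)
    have np: "norm (p /\<^sub>R 2) = 1/2" using p by simp
    have close: "\<bar>norm x - 1/2\<bar> < \<rho>"
      using norm_triangle_ineq3[of x "p /\<^sub>R 2"] x np by linarith
    then have nx: "1/4 < norm x" "norm x < 3/4" using \<rho>0 by linarith+
    then have x0: "x \<noteq> 0" by auto
    have "norm (x - norm x *\<^sub>R p) \<le> norm (x - p /\<^sub>R 2) + norm ((1/2 - norm x) *\<^sub>R p)"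
      by (rule order_trans[OF _ norm_triangle_ineq]) (simp add: algebra_simps)
    also have "\<dots> \<le> 2 * \<rho>" using x close p by simp
    finally have 1: "norm (x - norm x *\<^sub>R p) \<le> 2 * \<rho>" .
    have "norm (x /\<^sub>R norm x - p) = norm (inverse (norm x) *\<^sub>R (x - norm x *\<^sub>R p))"
    proof -
      have "inverse (norm x) * norm x = 1" using nx by (intro left_inverse) auto
      then show ?thesis by (simp only: scaleR_diff_right scaleR_scaleR scaleR_one)
    qed
    also have "\<dots> = norm (x - norm x *\<^sub>R p) / norm x"
      by (simp add: divide_inverse mult.commute)
    also have "\<dots> \<le> (2 * \<rho>) / (1/4)"
      using 1 nx \<rho>0 by (intro frac_le) auto
    finally have "norm (x /\<^sub>R norm x - p) \<le> r" using \<rho>0 by simp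
    then show "x \<in> {x. 0 < norm x \<and> norm x \<le> 1 \<and> x /\<^sub>R norm x \<in> ?cap}"
      using nx x0 by (auto simp: dist_norm norm_minus_commute)
  qed
  have "ennreal (unit_ball_vol (DIM('a)) * \<rho> ^ DIM('a)) = emeasure lborel (ball (p /\<^sub>R 2) \<rho>)"
    using \<rho>0 by (simp add: emeasure_ball)
  also have "\<dots> \<le> emeasure lborel {x. 0 < norm x \<and> norm x \<le> 1 \<and> x /\<^sub>R norm x \<in> ?cap}"
  proof (rule emeasure_mono[OF sub])
    have [measurable]: "?cap \<in> sets borel" by simp
    have "{x::'a. 0 < norm x \<and> norm x \<le> 1 \<and> x /\<^sub>R norm x \<in> ?cap} \<in> sets borel"
      by measurable
    then show "{x::'a. 0 < norm x \<and> norm x \<le> 1 \<and> x /\<^sub>R norm x \<in> ?cap} \<in> sets lborel" by simp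
  qed
  also have "\<dots> \<le> of_nat DIM('a) * \<dots>"
  proof -
    have "(1::ennreal) \<le> of_nat DIM('a)"
      using DIM_positive[where 'a='a] by (metis Suc_leI of_nat_1 of_nat_mono One_nat_def)
    from mult_right_mono[OF this zero_le] show ?thesis by (simp only: mult_1_left)
  qed
  also have "\<dots> = emeasure sphere_measure ?cap"
    by (rule emeasure_sphere_measure[OF cap, symmetric])
  also have "\<dots> = ennreal (measure sphere_measure ?cap)"
    by (rule sphere.emeasure_eq_measure)
  finally show ?thesis by (simp add: ennreal_le_iff)
qed

lemma continuous_on_sphere_measurable:
  "continuous_on (sphere 0 1) u \<Longrightarrow> u \<in> borel_measurable sphere_measure"
  using borel_measurable_continuous_on_restrict[of "sphere 0 1" u]
    measurable_cong_sets[OF sets_sphere_measure refl] by blast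

lemma continuous_in_L2_sphere:
  fixes u :: "'a::euclidean_space \<Rightarrow> real"
  assumes "continuous_on (sphere 0 1) u"
  shows "u \<in> L2_sphere"
proof -
  have [measurable]: "u \<in> borel_measurable sphere_measure"
    using assms by (rule continuous_on_sphere_measurable)
  have "bounded ((\<lambda>p. (u p)\<^sup>2) ` sphere 0 1)"
    by (intro compact_imp_bounded compact_continuous_image continuous_intros assms) auto
  then obtain C where C: "\<forall>y\<in>(\<lambda>p. (u p)\<^sup>2) ` sphere 0 1. norm y \<le> C"
    unfolding bounded_iff by blast
  have "integrable sphere_measure (\<lambda>p. (u p)\<^sup>2)"
    by (rule sphere.integrable_const_bound[of _ C])
       (use C in \<open>auto simp: space_sphere_measure intro!: AE_I2\<close>)
  then show ?thesis by (simp add: L2_sphere_def)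
qed

lemma L2_sphere_D:
  "h \<in> L2_sphere \<Longrightarrow> h \<in> borel_measurable sphere_measure"
  "h \<in> L2_sphere \<Longrightarrow> integrable sphere_measure (\<lambda>p. (h p)\<^sup>2)"
  by (auto simp: L2_sphere_def)

lemma L2_mult_integrable:
  assumes "h \<in> L2_sphere" "k \<in> L2_sphere"
  shows "integrable sphere_measure (\<lambda>p. h p * k p)"
proof (rule Bochner_Integration.integrable_bound)
  show "integrable sphere_measure (\<lambda>p. (h p)\<^sup>2 + (k p)\<^sup>2)"
    using assms by (auto simp: L2_sphere_def)
  show "(\<lambda>p. h p * k p) \<in> borel_measurable sphere_measure"
    using assms[THEN L2_sphere_D(1)] by measurable
  have "\<bar>a * b\<bar> \<le> a\<^sup>2 + b\<^sup>2" for a b :: real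
  proof -
    have "2 * \<bar>a\<bar> * \<bar>b\<bar> \<le> a\<^sup>2 + b\<^sup>2"
      using sum_squares_bound[of "\<bar>a\<bar>" "\<bar>b\<bar>"] by simp
    moreover have "0 \<le> \<bar>a\<bar> * \<bar>b\<bar>" by simp
    ultimately show ?thesis unfolding abs_mult by linarith
  qed
  then show "AE p in sphere_measure. norm (h p * k p) \<le> norm ((h p)\<^sup>2 + (k p)\<^sup>2)"
    by (auto intro!: AE_I2)
qed

lemma L2_lincomb:
  assumes "h \<in> L2_sphere" "k \<in> L2_sphere"
  shows "(\<lambda>p. a * h p + b * k p) \<in> L2_sphere"
    and "(LINT p|sphere_measure. (a * h p + b * k p)\<^sup>2) =
      a\<^sup>2 * (LINT p|sphere_measure. (h p)\<^sup>2) + 2 * a * b * (LINT p|sphere_measure. h p * k p)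
      + b\<^sup>2 * (LINT p|sphere_measure. (k p)\<^sup>2)"
proof -
  have eq: "(a * h p + b * k p)\<^sup>2 = a\<^sup>2 * (h p)\<^sup>2 + 2 * a * b * (h p * k p) + b\<^sup>2 * (k p)\<^sup>2" for p
    by (simp add: power2_eq_square algebra_simps)
  have m [measurable]: "h \<in> borel_measurable sphere_measure" "k \<in> borel_measurable sphere_measure"
    using assms by (auto simp: L2_sphere_def)
  note i = L2_sphere_D(2)[OF assms(1)] L2_sphere_D(2)[OF assms(2)] L2_mult_integrable[OF assms]
  show "(\<lambda>p. a * h p + b * k p) \<in> L2_sphere"
    using i by (simp add: L2_sphere_def eq)
  show "(LINT p|sphere_measure. (a * h p + b * k p)\<^sup>2) =
      a\<^sup>2 * (LINT p|sphere_measure. (h p)\<^sup>2) + 2 * a * b * (LINT p|sphere_measure. h p * k p)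
      + b\<^sup>2 * (LINT p|sphere_measure. (k p)\<^sup>2)"
    unfolding eq using i by simp
qed

lemma L2_diff:
  assumes "h \<in> L2_sphere" "k \<in> L2_sphere"
  shows "(\<lambda>p. h p - k p) \<in> L2_sphere"
  using L2_lincomb(1)[OF assms, of 1 "-1"] by simp

lemma norm_L2_nonneg [simp]: "0 \<le> norm_L2 h"
  by (simp add: norm_L2_def)

lemma norm_L2_square: "(norm_L2 h)\<^sup>2 = (LINT p|sphere_measure. (h p)\<^sup>2)"
  by (simp add: norm_L2_def)

lemma norm_L2_cong_AE:
  assumes "h \<in> borel_measurable sphere_measure" "k \<in> borel_measurable sphere_measure"
    and "AE p in sphere_measure. h p = k p"
  shows "norm_L2 h = norm_L2 k"
proof -
  have "(LINT p|sphere_measure. (h p)\<^sup>2) = (LINT p|sphere_measure. (k p)\<^sup>2)"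
    using assms by (intro integral_cong_AE) auto
  then show ?thesis by (simp add: norm_L2_def)
qed

lemma norm_L2_eq_0_iff:
  assumes "h \<in> L2_sphere"
  shows "norm_L2 h = 0 \<longleftrightarrow> (AE p in sphere_measure. h p = 0)"
  using integral_nonneg_eq_0_iff_AE[OF L2_sphere_D(2)[OF assms]] by (simp add: norm_L2_def)

lemma norm_L2_parallelogram:
  assumes "h \<in> L2_sphere" "k \<in> L2_sphere"
  shows "(norm_L2 (\<lambda>p. (h p + k p) / 2))\<^sup>2 =
    ((norm_L2 h)\<^sup>2 + (norm_L2 k)\<^sup>2) / 2 - (norm_L2 (\<lambda>p. h p - k p))\<^sup>2 / 4"
  using L2_lincomb(2)[OF assms, of "1/2" "1/2"] L2_lincomb(2)[OF assms, of 1 "-1"]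
  unfolding norm_L2_square by (simp add: add_divide_distrib diff_divide_distrib power2_eq_square)

text \<open>
The Cauchy-Schwarz inequality comes from integrating the square of \<open>\<parallel>k\<parallel> * h - \<parallel>h\<parallel> * k\<close>; when one of the
norms vanishes that gives nothing, but then the product vanishes almost everywhere.
\<close>
lemma norm_L2_triangle:
  assumes "h \<in> L2_sphere" "k \<in> L2_sphere"
  shows "norm_L2 (\<lambda>p. h p + k p) \<le> norm_L2 h + norm_L2 k"
proof (rule power2_le_imp_le)
  let ?a = "norm_L2 h" and ?b = "norm_L2 k" and ?c = "LINT p|sphere_measure. h p * k p"
  have "0 \<le> (LINT p|sphere_measure. (?b * h p + (- ?a) * k p)\<^sup>2)"
    by (intro integral_nonneg_AE AE_I2) simp
  then have *: "2 * (?a * ?b) * ?c \<le> 2 * (?a * ?b) * (?a * ?b)"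
    unfolding L2_lincomb(2)[OF assms] norm_L2_square[symmetric] 
    by (simp add: power2_eq_square algebra_simps)
  have "?c \<le> ?a * ?b"
  proof (cases "?a * ?b = 0")
    case True
    then have "(AE p in sphere_measure. h p = 0) \<or> (AE p in sphere_measure. k p = 0)"
      using norm_L2_eq_0_iff assms by auto
    then have "AE p in sphere_measure. h p * k p = 0" by auto
    from integral_eq_zero_AE[OF this] True show ?thesis by simp
  next
    case False
    moreover have "0 \<le> ?a * ?b" by simp
    ultimately have "0 < 2 * (?a * ?b)" by linarith
    with * show ?thesis by (metis mult_le_cancel_left_pos)
  qed
  then show "(norm_L2 (\<lambda>p. h p + k p))\<^sup>2 \<le> (?a + ?b)\<^sup>2"
    using L2_lincomb(2)[OF assms, of 1 1] unfolding norm_L2_square[symmetric]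
    by (simp add: power2_sum)
qed simp

text \<open>
If \<open>\<bar>u\<bar>\<close> reaches the value \<open>e\<close> at \<open>p\<close>, the Lipschitz condition keeps it above \<open>e / 2\<close> on a cap around \<open>p\<close>
whose radius depends on \<open>L\<close> and \<open>e\<close> only, and this contributes a fixed amount to the integral of \<open>u\<^sup>2\<close>.
So \<open>\<delta>\<close> serves all \<open>L\<close>-Lipschitz functions and all points at once.
\<close>
lemma lipschitz_small_L2_imp_small:
  fixes L e :: real
  assumes "0 \<le> L" "0 < e"
  shows "\<exists>\<delta>>0. \<forall>u :: 'a::euclidean_space \<Rightarrow> real. L-lipschitz_on (sphere 0 1) u \<longrightarrow>
    norm_L2 u < \<delta> \<longrightarrow> (\<forall>p\<in>sphere 0 1. \<bar>u p\<bar> < e)"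
proof -
  \<comment> \<open>The summand \<open>1\<close> keeps the radius finite when \<open>L = 0\<close>.\<close>
  define r where "r = e / (2 * (L + 1))"
  define \<rho> where "\<rho> = min (1/4) (r/8)"
  define v where "v = unit_ball_vol (DIM('a)) * \<rho> ^ DIM('a)"
  have r: "0 < r" using assms by (simp add: r_def)
  then have v: "0 < v" by (simp add: v_def \<rho>_def)
  have Lr: "L * r \<le> e / 2"
  proof -
    have "L * r \<le> (L + 1) * r" using r by simp
    also have "\<dots> = e / 2" using assms(1) by (simp add: r_def divide_simps)
    finally show ?thesis .
  qed
  show ?thesis
  proof (intro exI[of _ "e / 2 * sqrt v"] conjI allI impI ballI)
    show "0 < e / 2 * sqrt v" using v assms(2) by simp
    fix u :: "'a \<Rightarrow> real" and p :: 'a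
    assume u: "L-lipschitz_on (sphere 0 1) u" and small: "norm_L2 u < e / 2 * sqrt v"
      and p: "p \<in> sphere 0 1"
    show "\<bar>u p\<bar> < e"
    proof (rule ccontr)
      assume neg: "\<not> \<bar>u p\<bar> < e"
      let ?cap = "sphere 0 1 \<inter> cball p r"
      have cap: "?cap \<in> sets sphere_measure"
        unfolding sets_sphere_measure by (auto simp: sets_restrict_space)
      have uL2: "u \<in> L2_sphere"
        using lipschitz_on_continuous_on[OF u] by (rule continuous_in_L2_sphere)
      have ge: "(e/2)\<^sup>2 * indicat_real ?cap q \<le> (u q)\<^sup>2" for q
      proof (cases "q \<in> ?cap")
        case True
        then have "\<bar>u p - u q\<bar> \<le> L * r"
          using lipschitz_onD[OF u p, of q] assms(1) mult_left_mono[of "dist p q" r L]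
          by (simp add: dist_real_def)
        then have "e / 2 \<le> \<bar>u q\<bar>" using Lr neg by linarith
        then have "(e/2)\<^sup>2 \<le> \<bar>u q\<bar>\<^sup>2" using assms(2) by (intro power_mono) auto
        then show ?thesis using True by simp
      qed auto
      have "(e/2)\<^sup>2 * v \<le> (e/2)\<^sup>2 * measure sphere_measure ?cap"
        unfolding v_def using sphere_cap_measure_ge[OF p r \<rho>_def] by (intro mult_left_mono) auto
      also have "\<dots> = (LINT q|sphere_measure. (e/2)\<^sup>2 * indicator ?cap q)"
        using cap by simp
      also have "\<dots> \<le> (LINT q|sphere_measure. (u q)\<^sup>2)"
        using cap ge uL2[THEN L2_sphere_D(2)]
        by (intro integral_mono) (auto simp: sphere.emeasure_eq_measure)
      finally have "(e / 2 * sqrt v)\<^sup>2 \<le> (norm_L2 u)\<^sup>2"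
        using v by (simp add: norm_L2_square power_mult_distrib power_divide)
      then have "e / 2 * sqrt v \<le> norm_L2 u"
        by (rule power2_le_imp_le) simp
      with small show False by simp
    qed
  qed
qed

text \<open>
Used to pass from equality in \<open>L\<^sup>2\<close> to equality of support functions, and so of sets.
\<close>
lemma lipschitz_AE_eq_imp_eq:
  fixes u v :: "'a::euclidean_space \<Rightarrow> real"
  assumes "L-lipschitz_on (sphere 0 1) u" "K-lipschitz_on (sphere 0 1) v"
    and ae: "AE p in sphere_measure. u p = v p" and "p \<in> sphere 0 1"
  shows "u p = v p"
proof -
  have lip: "(L + K)-lipschitz_on (sphere 0 1) (\<lambda>p. u p - v p)"
    using assms(1,2) by (rule lipschitz_on_diff)
  have "AE p in sphere_measure. u p - v p = 0"
    using ae by simp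
  then have 0: "norm_L2 (\<lambda>p. u p - v p) = 0"
    using norm_L2_eq_0_iff[OF continuous_in_L2_sphere[OF lipschitz_on_continuous_on[OF lip]]]
    by blast
  have "\<bar>u p - v p\<bar> < e" if e: "0 < e" for e
  proof -
    obtain \<delta> where \<delta>: "0 < \<delta>"
      "\<forall>u :: 'a \<Rightarrow> real. (L + K)-lipschitz_on (sphere 0 1) u \<longrightarrow>
        norm_L2 u < \<delta> \<longrightarrow> (\<forall>p\<in>sphere 0 1. \<bar>u p\<bar> < e)"
      using lipschitz_small_L2_imp_small[OF lipschitz_on_nonneg[OF lip] e, where 'a='a] by blast
    show ?thesis using \<delta>(2)[rule_format, OF lip _ assms(4)] \<delta>(1) 0 by simp
  qed
  then have "\<bar>u p - v p\<bar> \<le> 0" by (meson less_irrefl not_le)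
  then show ?thesis by simp
qed

lemma Psi_lipschitz: "F \<in> KkcB B \<Longrightarrow> B-lipschitz_on (sphere 0 1) (Psi F)"
  using lipschitz_on_subset[OF support_fun_lipschitz, of F B "sphere 0 1"]
  by (simp add: lipschitz_on_def)

lemma Psi_in_L2: "F \<in> KkcB B \<Longrightarrow> Psi F \<in> L2_sphere"
  by (rule continuous_in_L2_sphere[OF lipschitz_on_continuous_on[OF Psi_lipschitz]])

text \<open>
The support function is positively homogeneous, so the bound on the sphere extends to all \<open>p\<close>.
\<close>
lemma d_kc_small_imp_close:
  fixes e :: real
  assumes "0 < e"
  shows "\<exists>\<delta>>0. \<forall>F\<in>KkcB B. \<forall>G\<in>KkcB B. d_kc F G < \<delta> \<longrightarrow>
    (\<forall>p :: 'a::euclidean_space. \<bar>support_fun p F - support_fun p G\<bar> \<le> e * norm p)"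
proof -
  obtain \<delta> where \<delta>: "0 < \<delta>" and small:
    "\<forall>u :: 'a \<Rightarrow> real. (\<bar>B\<bar> + \<bar>B\<bar>)-lipschitz_on (sphere 0 1) u \<longrightarrow>
        norm_L2 u < \<delta> \<longrightarrow> (\<forall>p\<in>sphere 0 1. \<bar>u p\<bar> < e)"
    using lipschitz_small_L2_imp_small[OF _ assms, of "\<bar>B\<bar> + \<bar>B\<bar>", where 'a='a] by auto
  show ?thesis
  proof (intro exI[of _ \<delta>] conjI ballI allI impI \<delta>)
    fix F G :: "'a set" and p
    assume F: "F \<in> KkcB B" and G: "G \<in> KkcB B" and d: "d_kc F G < \<delta>"
    have B: "B = \<bar>B\<bar>" using KkcB_nonneg[OF F] by simp
    have K: "F \<in> Kkc" "G \<in> Kkc" using F G by (auto simp: KkcB_iff)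
    show "\<bar>support_fun p F - support_fun p G\<bar> \<le> e * norm p"
    proof (cases "p = 0")
      case True
      then show ?thesis
        using support_fun_scale[OF K(1), of 0 p] support_fun_scale[OF K(2), of 0 p] by simp
    next
      case False
      define q where "q = p /\<^sub>R norm p"
      have q: "q \<in> sphere 0 1" and pq: "p = norm p *\<^sub>R q" using False by (auto simp: q_def)
      have "(\<bar>B\<bar> + \<bar>B\<bar>)-lipschitz_on (sphere 0 1) (\<lambda>p. Psi F p - Psi G p)"
        using lipschitz_on_diff[OF Psi_lipschitz[OF F] Psi_lipschitz[OF G]] B by simp
      from small[rule_format, OF this _ q] d q have "\<bar>support_fun q F - support_fun q G\<bar> \<le> e"
        by (simp add: d_kc_def)
      moreover have "support_fun p H = norm p * support_fun q H" if "H \<in> Kkc" for H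
        using support_fun_scale[OF that, of "norm p" q] pq by simp
      ultimately have "\<bar>support_fun p F - support_fun p G\<bar> = norm p * \<bar>support_fun q F - support_fun q G\<bar>"
        using K by (simp add: abs_mult flip: right_diff_distrib)
      also have "\<dots> \<le> norm p * e"
        using \<open>\<bar>support_fun q F - support_fun q G\<bar> \<le> e\<close> by (intro mult_left_mono) auto
      finally show ?thesis by (simp add: mult.commute)
    qed
  qed
qed

section \<open>Measurability for the metric on convex bodies\<close>

lemma d_kc_metric: "Metric_space (KkcB B) d_kc"
proof
  show "0 \<le> d_kc F G" for F G :: "'a set" by (simp add: d_kc_def)
  show "d_kc F G = d_kc G F" for F G :: "'a set"
    by (simp add: d_kc_def norm_L2_def power2_commute)
  show "d_kc F G = 0 \<longleftrightarrow> F = G" if "F \<in> KkcB B" "G \<in> KkcB B" for F G :: "'a set"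
  proof
    assume "d_kc F G = 0"
    then have "AE p in sphere_measure. Psi F p = Psi G p"
      using norm_L2_eq_0_iff[OF L2_diff[OF that[THEN Psi_in_L2]]] by (simp add: d_kc_def)
    then have "Psi F p = Psi G p" if "p \<in> sphere 0 1" for p
      by (rule lipschitz_AE_eq_imp_eq[OF Psi_lipschitz Psi_lipschitz _ that, rotated 2])
        (use \<open>F \<in> _\<close> \<open>G \<in> _\<close> in auto)
    then show "F = G" using that by (intro Psi_inj) (auto simp: KkcB_iff)
  qed (simp add: d_kc_def norm_L2_def)
  show "d_kc F H \<le> d_kc F G + d_kc G H"
    if "F \<in> KkcB B" "G \<in> KkcB B" "H \<in> KkcB B" for F G H :: "'a set"
    using norm_L2_triangle[OF L2_diff[OF that(1,2)[THEN Psi_in_L2]] L2_diff[OF that(2,3)[THEN Psi_in_L2]]]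
    by (simp add: d_kc_def)
qed

lemma space_borel_KkcB: "space (borel_KkcB B) = KkcB B"
  unfolding borel_KkcB_def
  by (intro space_measure_of) (auto simp: Metric_space.openin_mtopology[OF d_kc_metric])

text \<open>
The measurable space on convex bodies is generated by the open sets of the metric topology, so
continuity for \<open>d_kc\<close> gives measurability.
\<close>
lemma borel_KkcB_measurableI:
  fixes \<phi> :: "'a::euclidean_space set \<Rightarrow> 'b::metric_space"
  assumes cont: "\<And>F e. F \<in> KkcB B \<Longrightarrow> 0 < e \<Longrightarrow>
    \<exists>\<delta>>0. \<forall>G\<in>KkcB B. d_kc F G < \<delta> \<longrightarrow> dist (\<phi> G) (\<phi> F) < e"
  shows "\<phi> \<in> borel_KkcB B \<rightarrow>\<^sub>M borel"
proof (rule borel_measurableI)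
  interpret Metric_space "KkcB B" "d_kc :: 'a set \<Rightarrow> _" by (rule d_kc_metric)
  fix U :: "'b set" assume U: "open U"
  have "openin mtopology (\<phi> -` U \<inter> KkcB B)"
    unfolding openin_mtopology
  proof (intro conjI allI impI)
    fix F assume F: "F \<in> \<phi> -` U \<inter> KkcB B"
    then obtain e where e: "0 < e" "\<And>y. dist y (\<phi> F) < e \<Longrightarrow> y \<in> U"
      using U by (auto simp: open_dist)
    obtain \<delta> where "0 < \<delta>" "\<forall>G\<in>KkcB B. d_kc F G < \<delta> \<longrightarrow> dist (\<phi> G) (\<phi> F) < e"
      using cont e(1) F by blast
    then show "\<exists>r>0. mball F r \<subseteq> \<phi> -` U \<inter> KkcB B"
      using e(2) by (intro exI[of _ \<delta>]) (auto simp: in_mball)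
  qed simp
  then show "\<phi> -` U \<inter> space (borel_KkcB B) \<in> sets (borel_KkcB B)"
    unfolding space_borel_KkcB by (auto simp: borel_KkcB_def sets_measure_of_conv openin_mtopology)
qed

lemma support_fun_measurable:
  "support_fun p \<in> borel_measurable (borel_KkcB B)"
proof (rule borel_KkcB_measurableI)
  fix F :: "'a set" and e :: real assume F: "F \<in> KkcB B" and e: "0 < e"
  have e': "0 < e / (norm p + 1)"
    using e by (intro divide_pos_pos) (auto intro: add_nonneg_pos)
  obtain \<delta> where "0 < \<delta>" and \<delta>:
    "\<forall>F\<in>KkcB B. \<forall>G\<in>KkcB B. d_kc F G < \<delta> \<longrightarrow>
      (\<forall>q :: 'a. \<bar>support_fun q F - support_fun q G\<bar> \<le> e / (norm p + 1) * norm q)"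
    using d_kc_small_imp_close[OF e', of B, where 'a='a] by blast
  have "e / (norm p + 1) * norm p < e"
  proof -
    have "e / (norm p + 1) * norm p < e / (norm p + 1) * (norm p + 1)"
      using e' by (intro mult_strict_left_mono) auto
    also have "\<dots> = e"
      using norm_ge_zero[of p] by (simp add: add_nonneg_eq_0_iff)
    finally show ?thesis .
  qed
  then have "dist (support_fun p G) (support_fun p F) < e" if "G \<in> KkcB B" "d_kc F G < \<delta>" for G
    using \<delta>[rule_format, OF F that, of p] by (simp add: dist_real_def abs_minus_commute)
  with \<open>0 < \<delta>\<close> show "\<exists>\<delta>>0. \<forall>G\<in>KkcB B. d_kc F G < \<delta> \<longrightarrow> dist (support_fun p G) (support_fun p F) < e"
    by blast
qed

text \<open>
One half of the identity between the Hausdorff distance and the uniform distance of support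
functions: the unit vector from the nearest point of \<open>F\<close> towards \<open>b\<close> is an outer normal of \<open>F\<close> there, and
\<open>b\<close> lies beyond that supporting hyperplane by exactly its distance to \<open>F\<close>.
\<close>
lemma subset_dist_closest_point_le:
  fixes F G :: "'a::euclidean_space set"
  assumes F: "F \<in> Kkc" and G: "G \<in> Kkc" and b: "b \<in> G"
    and le: "\<And>p. p \<in> sphere 0 1 \<Longrightarrow> support_fun p G - support_fun p F \<le> \<delta>" and "0 \<le> \<delta>"
  shows "norm (b - closest_point F b) \<le> \<delta>"
proof (cases "b = closest_point F b")
  case False
  let ?c = "closest_point F b"
  define p where "p = (b - ?c) /\<^sub>R norm (b - ?c)"
  have p: "p \<in> sphere 0 1" using False by (simp add: p_def)
  have "support_fun p F \<le> p \<bullet> ?c"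
    unfolding support_fun_def
  proof (rule cSUP_least[OF Kkc_D(1)[OF F]])
    fix f assume "f \<in> F"
    then have "(b - ?c) \<bullet> (f - ?c) \<le> 0"
      using Kkc_D[OF F] by (intro closest_point_dot) auto
    then show "p \<bullet> f \<le> p \<bullet> ?c"
      by (simp add: p_def inner_diff_right mult_left_mono)
  qed
  moreover have "p \<bullet> b \<le> support_fun p G"
    using support_fun_upper[OF Kkc_D(2)[OF G] b] .
  moreover have "p \<bullet> b - p \<bullet> ?c = norm (b - ?c)"
  proof -
    have "p \<bullet> b - p \<bullet> ?c = ((b - ?c) \<bullet> (b - ?c)) / norm (b - ?c)"
      by (simp add: p_def inner_diff_right divide_inverse algebra_simps)
    also have "\<dots> = norm (b - ?c)"
      using False by (simp add: dot_square_norm power2_eq_square)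
    finally show ?thesis .
  qed
  ultimately show ?thesis using le[OF p] by linarith
qed (use assms(5) in simp)

text \<open>
Each of the two nearest points has, within \<open>\<delta>\<close>, a companion in the other set. Adding the obtuse-angle
inequalities of the two projections, tested at those companions, leaves the squared distance of
the nearest points on one side.
\<close>
lemma closest_point_stable:
  fixes F G :: "'a::euclidean_space set"
  assumes F: "F \<in> KkcB B" and G: "G \<in> KkcB B" and "0 \<le> \<delta>"
    and close: "\<And>p. p \<in> sphere 0 1 \<Longrightarrow> \<bar>support_fun p F - support_fun p G\<bar> \<le> \<delta>"
  shows "(norm (closest_point F q - closest_point G q))\<^sup>2 \<le> 2 * (norm q + B) * \<delta>"
proof -
  let ?a = "closest_point F q" and ?b = "closest_point G q"
  have K: "F \<in> Kkc" "G \<in> Kkc" using F G by (auto simp: KkcB_iff)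
  have a: "?a \<in> F" and b: "?b \<in> G" using closest_point_in_set Kkc_D K by metis+
  let ?a' = "closest_point G ?a" and ?b' = "closest_point F ?b"
  have a': "?a' \<in> G" and b': "?b' \<in> F" using closest_point_in_set Kkc_D K by metis+
  have da: "norm (?a' - ?a) \<le> \<delta>" and db: "norm (?b' - ?b) \<le> \<delta>"
    using subset_dist_closest_point_le[OF K(2,1) a, of \<delta>] subset_dist_closest_point_le[OF K b, of \<delta>]
      close assms(3) by (auto simp: norm_minus_commute abs_le_iff)
  have 1: "(q - ?a) \<bullet> (?b - ?a) \<le> (norm q + B) * \<delta>"
  proof -
    have "(q - ?a) \<bullet> (?b' - ?a) \<le> 0"
      using b' K Kkc_D by (intro closest_point_dot) auto
    then have "(q - ?a) \<bullet> (?b - ?a) \<le> (q - ?a) \<bullet> (?b - ?b')"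
      by (simp add: inner_diff_right)
    also have "\<dots> \<le> norm (q - ?a) * norm (?b - ?b')" by (rule norm_cauchy_schwarz)
    also have "\<dots> \<le> (norm q + B) * \<delta>"
      using norm_triangle_ineq4[of q ?a] KkcB_D(5)[OF F a] db assms(3) KkcB_nonneg[OF F]
      by (intro mult_mono) (auto simp: norm_minus_commute)
    finally show ?thesis .
  qed
  have 2: "(q - ?b) \<bullet> (?a - ?b) \<le> (norm q + B) * \<delta>"
  proof -
    have "(q - ?b) \<bullet> (?a' - ?b) \<le> 0"
      using a' K Kkc_D by (intro closest_point_dot) auto
    then have "(q - ?b) \<bullet> (?a - ?b) \<le> (q - ?b) \<bullet> (?a - ?a')"
      by (simp add: inner_diff_right)
    also have "\<dots> \<le> norm (q - ?b) * norm (?a - ?a')" by (rule norm_cauchy_schwarz)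
    also have "\<dots> \<le> (norm q + B) * \<delta>"
      using norm_triangle_ineq4[of q ?b] KkcB_D(5)[OF G b] da assms(3) KkcB_nonneg[OF F]
      by (intro mult_mono) (auto simp: norm_minus_commute)
    finally show ?thesis .
  qed
  have "(norm (?a - ?b))\<^sup>2 = (q - ?a) \<bullet> (?b - ?a) + (q - ?b) \<bullet> (?a - ?b)"
    by (simp add: power2_norm_eq_inner inner_diff_left inner_diff_right inner_commute algebra_simps)
  with 1 2 show ?thesis by linarith
qed

lemma closest_point_measurable:
  "(\<lambda>F. closest_point F q) \<in> borel_measurable (borel_KkcB B)"
proof (rule borel_KkcB_measurableI)
  fix F :: "'a set" and e :: real assume F: "F \<in> KkcB B" and e: "0 < e"
  \<comment> \<open>The summand \<open>1\<close> makes \<open>c\<close> positive and the final estimate strict.\<close>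
  define c where "c = 2 * (norm q + B) + 1"
  have c: "0 < c" using KkcB_nonneg[OF F] by (simp add: c_def add_nonneg_pos)
  have e': "0 < e\<^sup>2 / c" using e c by simp
  obtain \<delta> where "0 < \<delta>" and \<delta>:
    "\<forall>F\<in>KkcB B. \<forall>G\<in>KkcB B. d_kc F G < \<delta> \<longrightarrow>
      (\<forall>p :: 'a. \<bar>support_fun p F - support_fun p G\<bar> \<le> e\<^sup>2 / c * norm p)"
    using d_kc_small_imp_close[OF e', of B, where 'a='a] by blast
  have "dist (closest_point G q) (closest_point F q) < e" if G: "G \<in> KkcB B" "d_kc F G < \<delta>" for G
  proof -
    have "(norm (closest_point F q - closest_point G q))\<^sup>2 \<le> 2 * (norm q + B) * (e\<^sup>2 / c)"
    proof (rule closest_point_stable[OF F G(1)])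
      show "\<bar>support_fun p F - support_fun p G\<bar> \<le> e\<^sup>2 / c" if "p \<in> sphere 0 1" for p
        using \<delta>[rule_format, OF F G, of p] that by simp
    qed (use e' in simp)
    also have "\<dots> < c * (e\<^sup>2 / c)"
      using e' by (intro mult_strict_right_mono) (auto simp: c_def)
    finally show ?thesis
      using e c power2_less_imp_less[of "norm (closest_point F q - closest_point G q)" e]
      by (simp add: dist_norm norm_minus_commute)
  qed
  with \<open>0 < \<delta>\<close> show "\<exists>\<delta>>0. \<forall>G\<in>KkcB B. d_kc F G < \<delta> \<longrightarrow> dist (closest_point G q) (closest_point F q) < e"
    by blast
qed

text \<open>
Projecting the distant point \<open>t *\<^sub>R p\<close> is maximizing \<open>p \<bullet> g - norm g\<^sup>2 / (2 * t)\<close> over \<open>g\<close> in \<open>F\<close>. This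
replaces a measurable choice among the maximizers of \<open>p\<close>, which need not be unique, by a
nearest-point map, which is single-valued and continuous in \<open>F\<close>.
\<close>
lemma closest_point_nearly_maximizes:
  fixes F :: "'a::euclidean_space set"
  assumes F: "F \<in> KkcB B" and f: "f \<in> F" and t: "0 < t"
  shows "p \<bullet> f - B\<^sup>2 / (2 * t) \<le> p \<bullet> closest_point F (t *\<^sub>R p)"
proof -
  let ?g = "closest_point F (t *\<^sub>R p)"
  have "(norm (t *\<^sub>R p - ?g))\<^sup>2 \<le> (norm (t *\<^sub>R p - f))\<^sup>2"
    using closest_point_le[OF KkcB_D(4)[OF F] f, of "t *\<^sub>R p"] by (simp add: dist_norm)
  then have "(norm ?g)\<^sup>2 - 2 * t * (p \<bullet> ?g) \<le> (norm f)\<^sup>2 - 2 * t * (p \<bullet> f)"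
    by (simp add: power2_norm_eq_inner inner_diff_left inner_diff_right inner_commute algebra_simps)
  moreover have "(norm f)\<^sup>2 \<le> B\<^sup>2" using KkcB_D(5)[OF F f] by (intro power_mono) auto
  ultimately have "2 * t * (p \<bullet> f) - B\<^sup>2 \<le> 2 * t * (p \<bullet> ?g)"
    using zero_le_power2[of "norm ?g"] by linarith
  then show ?thesis using t by (simp add: field_simps)
qed

section \<open>Projection onto the set of support functions\<close>

text \<open>
Near-minimizers of the distance to \<open>m\<close> are \<open>d_kc\<close>-Cauchy, so their support functions converge
pointwise to that of some \<open>G\<close>, which attains the minimum by dominated convergence. A second minimizer would have
a strictly better midpoint with \<open>G\<close>.
\<close>
lemma closed_convex_projection:
  fixes m :: "'a::euclidean_space \<Rightarrow> real"
  assumes m: "m \<in> L2_sphere" and "0 \<le> B"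
  obtains G where "G \<in> KkcB B"
    "\<And>H. H \<in> KkcB B \<Longrightarrow> H \<noteq> G \<Longrightarrow> norm_L2 (\<lambda>p. Psi G p - m p) < norm_L2 (\<lambda>p. Psi H p - m p)"
proof -
  define Q where "Q H = (norm_L2 (\<lambda>p. Psi H p - m p))\<^sup>2" for H
  have ne: "KkcB B \<noteq> ({} :: 'a set set)"
  proof -
    have "{0 :: 'a} \<in> KkcB B" using assms(2) by (auto simp: KkcB_iff Kkc_def)
    then show ?thesis by blast
  qed
  have mid: "\<exists>K\<in>KkcB B. Q K \<le> (Q H + Q H') / 2 - (d_kc H H')\<^sup>2 / 4"
    if H: "H \<in> KkcB B" "H' \<in> KkcB B" for H H' :: "'a set"
  proof -
    obtain K where K: "K \<in> KkcB B" "\<And>p. support_fun p K = (support_fun p H + support_fun p H') / 2"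
      using KkcB_midpoint[OF H] by metis
    have "Q K = (norm_L2 (\<lambda>p. ((Psi H p - m p) + (Psi H' p - m p)) / 2))\<^sup>2"
      unfolding Q_def norm_L2_square
      by (intro Bochner_Integration.integral_cong) (auto simp: space_sphere_measure K(2) field_simps)
    also have "\<dots> = (Q H + Q H') / 2 - (d_kc H H')\<^sup>2 / 4"
      using norm_L2_parallelogram[OF L2_diff[OF Psi_in_L2[OF H(1)] m] L2_diff[OF Psi_in_L2[OF H(2)] m]]
      by (simp add: Q_def d_kc_def)
    finally show ?thesis using K(1) by force
  qed
  define C where "C = (B * sqrt (measure (sphere_measure :: 'a measure) (sphere 0 1)) + norm_L2 m)\<^sup>2"
  have QC: "Q H \<le> C" if H: "H \<in> KkcB B" for H :: "'a set"
  proof -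
    have "norm_L2 (Psi H) \<le> B * sqrt (measure (sphere_measure :: 'a measure) (sphere 0 1))"
    proof (rule power2_le_imp_le)
      have le: "(Psi H p)\<^sup>2 \<le> B\<^sup>2" if "p \<in> sphere 0 1" for p
        using support_fun_bound[OF H, of p] that assms(2) by (simp add: abs_le_square_iff[symmetric])
      have "(LINT p|sphere_measure. (Psi H p)\<^sup>2) \<le> (LINT p|(sphere_measure :: 'a measure). B\<^sup>2)"
        using le L2_sphere_D(2)[OF Psi_in_L2[OF H]]
        by (intro integral_mono) (auto simp: space_sphere_measure)
      then show "(norm_L2 (Psi H))\<^sup>2 \<le> (B * sqrt (measure (sphere_measure :: 'a measure) (sphere 0 1)))\<^sup>2"
        by (simp add: norm_L2_square power_mult_distrib space_sphere_measure mult.commute)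
    qed (use assms(2) in simp)
    moreover have "norm_L2 (\<lambda>p. - m p) = norm_L2 m" by (simp add: norm_L2_def)
    moreover have "(\<lambda>p. - m p) \<in> L2_sphere" using m by (simp add: L2_sphere_def)
    ultimately have "norm_L2 (\<lambda>p. Psi H p - m p)
        \<le> B * sqrt (measure (sphere_measure :: 'a measure) (sphere 0 1)) + norm_L2 m"
      using norm_L2_triangle[OF Psi_in_L2[OF H], of "\<lambda>p. - m p"] by simp
    then show ?thesis unfolding Q_def C_def by (intro power_mono) auto
  qed
  obtain F where F: "\<And>n. F n \<in> KkcB B"
    and Fmin: "\<And>n H. H \<in> KkcB B \<Longrightarrow> Q (F n) \<le> Q H + 1 / real (Suc n)"
    and Cau: "\<And>e. e > 0 \<Longrightarrow> \<exists>N. \<forall>i\<ge>N. \<forall>j\<ge>N. (d_kc (F i) (F j))\<^sup>2 < e"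
    by (rule near_minimizers_Cauchy[where S="\<lambda>_. KkcB B :: 'a set set" and Q=Q and C=C
          and D="\<lambda>H H'. (d_kc H H')\<^sup>2"]) (use ne QC mid in \<open>auto simp: Q_def\<close>)
  have "convergent (\<lambda>n. support_fun p (F n))" if p: "p \<in> sphere 0 1" for p
  proof (rule Cauchy_convergent, rule metric_CauchyI)
    fix e :: real assume e: "0 < e"
    then have "0 < e / 2" by simp
    from d_kc_small_imp_close[OF this, of B, where 'a='a] obtain \<delta> where "0 < \<delta>" and \<delta>:
      "\<forall>F\<in>KkcB B. \<forall>G\<in>KkcB B. d_kc F G < \<delta> \<longrightarrow>
        (\<forall>p :: 'a. \<bar>support_fun p F - support_fun p G\<bar> \<le> e / 2 * norm p)" by blast
    obtain N where N: "\<forall>i\<ge>N. \<forall>j\<ge>N. (d_kc (F i) (F j))\<^sup>2 < \<delta>\<^sup>2"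
      using Cau[of "\<delta>\<^sup>2"] \<open>0 < \<delta>\<close> by auto
    have "dist (support_fun p (F i)) (support_fun p (F j)) < e" if "i \<ge> N" "j \<ge> N" for i j
    proof -
      have "d_kc (F i) (F j) < \<delta>"
        using N that \<open>0 < \<delta>\<close> by (auto intro: power2_less_imp_less)
      from \<delta>[rule_format, OF F F this, of p] p e show ?thesis by (simp add: dist_real_def)
    qed
    then show "\<exists>N. \<forall>i\<ge>N. \<forall>j\<ge>N. dist (support_fun p (F i)) (support_fun p (F j)) < e" by blast
  qed
  from KkcB_complete[OF F this] obtain G where G: "G \<in> KkcB B"
    and lim: "\<And>p. (\<lambda>n. support_fun p (F n)) \<longlonglongrightarrow> support_fun p G" by metis
  have [measurable]: "m \<in> borel_measurable sphere_measure" "Psi H \<in> borel_measurable sphere_measure"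
    if "H \<in> KkcB B" for H :: "'a set" using L2_sphere_D(1) m Psi_in_L2[OF that] by auto
  have "(\<lambda>n. Q (F n)) \<longlonglongrightarrow> Q G"
    unfolding Q_def norm_L2_square
  proof (rule integral_dominated_convergence[where w="\<lambda>p. 2 * B\<^sup>2 + 2 * (m p)\<^sup>2"])
    show "integrable sphere_measure (\<lambda>p. 2 * B\<^sup>2 + 2 * (m p)\<^sup>2)"
      using L2_sphere_D(2)[OF m] by simp
    show "AE p in sphere_measure. (\<lambda>n. (Psi (F n) p - m p)\<^sup>2) \<longlonglongrightarrow> (Psi G p - m p)\<^sup>2"
      by (rule AE_I2) (auto simp: space_sphere_measure intro!: tendsto_intros lim)
    fix n
    have sq: "(a - b)\<^sup>2 \<le> 2 * B\<^sup>2 + 2 * b\<^sup>2" if "\<bar>a\<bar> \<le> B" for a b :: real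
    proof -
      have "a\<^sup>2 \<le> B\<^sup>2" using that assms(2) by (simp add: abs_le_square_iff[symmetric])
      moreover have "0 \<le> (a + b)\<^sup>2" by simp
      ultimately show ?thesis by (simp add: power2_sum power2_diff)
    qed
    have "norm ((Psi (F n) p - m p)\<^sup>2) \<le> 2 * B\<^sup>2 + 2 * (m p)\<^sup>2" if "p \<in> sphere 0 1" for p
      using sq[of "Psi (F n) p" "m p"] support_fun_bound[OF F, of p n] that by simp
    then show "AE p in sphere_measure. norm ((Psi (F n) p - m p)\<^sup>2) \<le> 2 * B\<^sup>2 + 2 * (m p)\<^sup>2"
      by (intro AE_I2) (simp add: space_sphere_measure)
  qed (use F G in measurable)
  then have GQ: "Q G \<le> Q H" if "H \<in> KkcB B" for H
  proof (rule LIMSEQ_le)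
    show "(\<lambda>n. Q H + 1 / real (Suc n)) \<longlonglongrightarrow> Q H"
      using tendsto_add[OF tendsto_const LIMSEQ_Suc[OF lim_1_over_n]] by simp
  qed (use Fmin[OF that] in auto)
  have "Q G < Q H" if H: "H \<in> KkcB B" "H \<noteq> G" for H
  proof (rule ccontr)
    assume "\<not> Q G < Q H"
    obtain K where K: "K \<in> KkcB B" "Q K \<le> (Q G + Q H) / 2 - (d_kc G H)\<^sup>2 / 4"
      using mid[OF G H(1)] by blast
    with GQ[OF K(1)] \<open>\<not> Q G < Q H\<close> have "(d_kc G H)\<^sup>2 \<le> 0" by argo
    then have "d_kc G H = 0" by simp
    then show False using Metric_space.zero[OF d_kc_metric] G H by metis
  qed
  then show ?thesis
    using that[OF G] unfolding Q_def by (meson norm_L2_nonneg power2_less_imp_less)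
qed

section \<open>Convexity and closedness of the Aumann mean\<close>

lemma aumann_mean_convex:
  fixes G :: "'w \<Rightarrow> 'a::euclidean_space set"
  assumes "\<And>\<omega>. \<omega> \<in> space M \<Longrightarrow> convex (G \<omega>)"
  shows "convex (aumann_mean M G)"
proof (rule convexI)
  fix a b and u v :: real
  assume "a \<in> aumann_mean M G" "b \<in> aumann_mean M G" and uv: "0 \<le> u" "0 \<le> v" "u + v = 1"
  then obtain f g where fg: "integrable M f" "\<forall>\<omega>\<in>space M. f \<omega> \<in> G \<omega>" "a = (LINT \<omega>|M. f \<omega>)"
      "integrable M g" "\<forall>\<omega>\<in>space M. g \<omega> \<in> G \<omega>" "b = (LINT \<omega>|M. g \<omega>)"
    unfolding aumann_mean_def by blast
  then have "u *\<^sub>R a + v *\<^sub>R b = (LINT \<omega>|M. u *\<^sub>R f \<omega> + v *\<^sub>R g \<omega>)"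
    by simp
  moreover have "\<forall>\<omega>\<in>space M. u *\<^sub>R f \<omega> + v *\<^sub>R g \<omega> \<in> G \<omega>"
    using fg uv assms by (auto intro: convexD)
  moreover have "integrable M (\<lambda>\<omega>. u *\<^sub>R f \<omega> + v *\<^sub>R g \<omega>)"
    using fg by simp
  ultimately show "u *\<^sub>R a + v *\<^sub>R b \<in> aumann_mean M G"
    unfolding aumann_mean_def by blast
qed

text \<open>
Weak compactness of the set of bounded selections, made elementary. For a point \<open>c\<close> of the closure,
the selections whose means are within \<open>1 / Suc n\<close> of \<open>c\<close> form decreasing convex sets. Selections in
them of nearly minimal \<open>L\<^sup>2\<close> norm are Cauchy in \<open>L\<^sup>2\<close>, hence in \<open>L\<^sup>1\<close>; a subsequence converges almost
everywhere, to a selection with mean \<open>c\<close>. The values have to be convex for midpoints of selections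
to be selections.
\<close>
lemma (in prob_space) aumann_mean_closed:
  fixes G :: "'a \<Rightarrow> 'b::euclidean_space set"
  assumes cl: "\<And>\<omega>. \<omega> \<in> space M \<Longrightarrow> closed (G \<omega>)"
    and cv: "\<And>\<omega>. \<omega> \<in> space M \<Longrightarrow> convex (G \<omega>)"
    and bd: "\<And>\<omega> f. \<omega> \<in> space M \<Longrightarrow> f \<in> G \<omega> \<Longrightarrow> norm f \<le> C"
  shows "closed (aumann_mean M G)"
proof -
  have "c \<in> aumann_mean M G" if c: "c \<in> closure (aumann_mean M G)" for c
  proof -
    define S where "S n = {g. integrable M g \<and> (\<forall>\<omega>\<in>space M. g \<omega> \<in> G \<omega>)
      \<and> (LINT \<omega>|M. g \<omega>) \<in> cball c (1 / real (Suc n))}" for n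
    define Q where "Q g = (LINT \<omega>|M. (norm (g \<omega>))\<^sup>2)" for g :: "'a \<Rightarrow> 'b"
    define D where "D g h = (LINT \<omega>|M. (norm (g \<omega> - h \<omega>))\<^sup>2)" for g h :: "'a \<Rightarrow> 'b"
    have S_D: "integrable M g" "g \<in> borel_measurable M" "\<And>\<omega>. \<omega> \<in> space M \<Longrightarrow> g \<omega> \<in> G \<omega>"
      "\<And>\<omega>. \<omega> \<in> space M \<Longrightarrow> norm (g \<omega>) \<le> C" "dist c (LINT \<omega>|M. g \<omega>) \<le> 1 / real (Suc n)"
      if "g \<in> S n" for g n
      using that bd by (auto simp: S_def)
    have sq_int: "integrable M (\<lambda>\<omega>. (norm (g \<omega>))\<^sup>2)" if "g \<in> S n" for g n
    proof (rule integrable_const_bound[of _ "C\<^sup>2"])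
      show "AE \<omega> in M. norm ((norm (g \<omega>))\<^sup>2) \<le> C\<^sup>2"
        by (intro AE_I2) (simp add: power_mono S_D(4)[OF that])
    qed (use S_D(2)[OF that] in measurable)
    have diff_int: "integrable M (\<lambda>\<omega>. (norm (g \<omega> - h \<omega>))\<^sup>2)" if g: "g \<in> S n" and h: "h \<in> S m" for g h n m
    proof (rule integrable_const_bound[of _ "(C + C)\<^sup>2"])
      have "norm (g \<omega> - h \<omega>) \<le> C + C" if "\<omega> \<in> space M" for \<omega>
        using norm_triangle_ineq4[of "g \<omega>" "h \<omega>"] S_D(4)[OF g that] S_D(4)[OF h that] by linarith
      then have "(norm (g \<omega> - h \<omega>))\<^sup>2 \<le> (C + C)\<^sup>2" if "\<omega> \<in> space M" for \<omega>
        using that by (intro power_mono) auto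
      then show "AE \<omega> in M. norm ((norm (g \<omega> - h \<omega>))\<^sup>2) \<le> (C + C)\<^sup>2"
        by (intro AE_I2) (simp only: real_norm_def abs_power2)
    qed (use S_D(2)[OF g] S_D(2)[OF h] in measurable)
    have S_mid: "\<exists>z\<in>S n. Q z \<le> (Q g + Q h) / 2 - D g h / 4" if g: "g \<in> S n" and h: "h \<in> S n" for n g h
    proof
      let ?z = "\<lambda>\<omega>. (1/2) *\<^sub>R g \<omega> + (1/2) *\<^sub>R h \<omega>"
      have "(LINT \<omega>|M. ?z \<omega>) = (1/2) *\<^sub>R (LINT \<omega>|M. g \<omega>) + (1/2) *\<^sub>R (LINT \<omega>|M. h \<omega>)"
        using S_D(1) g h by simp
      also have "\<dots> \<in> cball c (1 / real (Suc n))"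
        using g h by (intro convexD[OF convex_cball]) (auto simp: S_def)
      finally have "(LINT \<omega>|M. ?z \<omega>) \<in> cball c (1 / real (Suc n))" .
      moreover have "?z \<omega> \<in> G \<omega>" if "\<omega> \<in> space M" for \<omega>
        using S_D(3)[OF g that] S_D(3)[OF h that] by (intro convexD[OF cv[OF that]]) auto
      moreover have "integrable M ?z" using S_D(1) g h by simp
      ultimately show "?z \<in> S n" unfolding S_def by blast
      have "(norm (?z \<omega>))\<^sup>2 = ((norm (g \<omega>))\<^sup>2 + (norm (h \<omega>))\<^sup>2) / 2 - (norm (g \<omega> - h \<omega>))\<^sup>2 / 4" for \<omega>
        by (simp add: power2_norm_eq_inner inner_add_left inner_add_right inner_diff_left
            inner_diff_right inner_commute add_divide_distrib diff_divide_distrib)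
      then have "Q ?z = (LINT \<omega>|M. ((norm (g \<omega>))\<^sup>2 + (norm (h \<omega>))\<^sup>2) / 2 - (norm (g \<omega> - h \<omega>))\<^sup>2 / 4)"
        by (simp add: Q_def)
      also have "\<dots> = (Q g + Q h) / 2 - D g h / 4"
        unfolding Q_def D_def using sq_int[OF g] sq_int[OF h] diff_int[OF g h] by simp
      finally show "Q ?z \<le> (Q g + Q h) / 2 - D g h / 4" by simp
    qed
    have S_ne: "S n \<noteq> {}" for n
    proof -
      have "0 < 1 / real (Suc n)" by simp
      then obtain y where "y \<in> aumann_mean M G" "dist y c < 1 / real (Suc n)"
        using c unfolding closure_approachable by blast
      then obtain g where "integrable M g" "\<forall>\<omega>\<in>space M. g \<omega> \<in> G \<omega>"
          "dist (LINT \<omega>|M. g \<omega>) c < 1 / real (Suc n)"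
        unfolding aumann_mean_def by blast
      then have "g \<in> S n" by (simp add: S_def dist_commute)
      then show ?thesis by blast
    qed
    have S_dec: "S n \<subseteq> S m" if "m \<le> n" for m n
    proof -
      have "1 / real (Suc n) \<le> 1 / real (Suc m)" using that by (simp add: frac_le)
      then show ?thesis unfolding S_def by (auto simp del: of_nat_Suc intro: order_trans)
    qed
    have Q_le: "Q g \<le> C\<^sup>2" if "g \<in> S n" for g n
    proof -
      have "Q g \<le> (LINT \<omega>|M. C\<^sup>2)"
        unfolding Q_def using S_D(4)[OF that] by (intro integral_mono sq_int[OF that]) (auto intro: power_mono)
      then show ?thesis by (simp add: prob_space)
    qed
    obtain x where x: "\<And>n. x n \<in> S n"
      and Cau: "\<And>e. e > 0 \<Longrightarrow> \<exists>N. \<forall>m\<ge>N. \<forall>n\<ge>N. D (x m) (x n) < e"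
      by (rule near_minimizers_Cauchy[of S Q "C\<^sup>2" D])
        (use S_dec S_ne Q_le S_mid in \<open>auto simp: Q_def\<close>)
    have "\<exists>N. \<forall>i\<ge>N. \<forall>j\<ge>N. (LINT \<omega>|M. norm (x i \<omega> - x j \<omega>)) < e" if e: "0 < e" for e
    proof -
      obtain N where N: "\<forall>m\<ge>N. \<forall>n\<ge>N. D (x m) (x n) < e\<^sup>2"
        using Cau[of "e\<^sup>2"] e by auto
      have "(LINT \<omega>|M. norm (x i \<omega> - x j \<omega>)) < e" if ij: "i \<ge> N" "j \<ge> N" for i j
      proof -
        \<comment> \<open>Weighted form of the inequality of means; it bounds the \<open>L\<^sup>1\<close> distance by the squared \<open>L\<^sup>2\<close> distance.\<close>
        have ptw: "t \<le> e / 2 + t\<^sup>2 / (2 * e)" for t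
        proof -
          have "2 * e * t \<le> e * e + t * t"
            using sum_squares_bound[of e t] by (simp add: power2_eq_square)
          then show ?thesis using e by (simp add: field_simps power2_eq_square)
        qed
        have "(LINT \<omega>|M. norm (x i \<omega> - x j \<omega>))
            \<le> (LINT \<omega>|M. e / 2 + (norm (x i \<omega> - x j \<omega>))\<^sup>2 / (2 * e))"
          using S_D(1)[OF x] diff_int[OF x x] by (intro integral_mono ptw) auto
        also have "\<dots> = e / 2 + D (x i) (x j) / (2 * e)"
          unfolding D_def using diff_int[OF x x] by (simp add: prob_space)
        also have "\<dots> < e / 2 + e\<^sup>2 / (2 * e)"
          using N ij e by (intro add_strict_left_mono divide_strict_right_mono) auto
        also have "\<dots> = e" using e by (simp add: power2_eq_square)
        finally show ?thesis .
      qed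
      then show ?thesis by blast
    qed
    then obtain r where r: "strict_mono r" and AEC: "AE \<omega> in M. Cauchy (\<lambda>i. x (r i) \<omega>)"
      using cauchy_L1_AE_cauchy_subseq[of M x] S_D(1)[OF x] by blast
    have [measurable]: "x n \<in> borel_measurable M" for n using S_D(2)[OF x] .
    \<comment> \<open>On the null set without convergence, \<open>x 0\<close> keeps \<open>g\<close> a selection at every point.\<close>
    define g where "g \<omega> = (if Cauchy (\<lambda>i. x (r i) \<omega>) then lim (\<lambda>i. x (r i) \<omega>) else x 0 \<omega>)" for \<omega>
    have g_meas [measurable]: "g \<in> borel_measurable M" unfolding g_def by measurable
    have g_sel: "g \<omega> \<in> G \<omega>" if w: "\<omega> \<in> space M" for \<omega>
    proof (cases "Cauchy (\<lambda>i. x (r i) \<omega>)")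
      case True
      then have "(\<lambda>i. x (r i) \<omega>) \<longlonglongrightarrow> g \<omega>"
        by (simp add: g_def Cauchy_convergent_iff convergent_LIMSEQ_iff)
      then show ?thesis
        by (rule closed_sequentially[OF cl[OF w], rotated]) (rule S_D(3)[OF x w])
    next
      case False
      then show ?thesis using S_D(3)[OF x w] by (simp add: g_def)
    qed
    have g_int: "integrable M g"
      using g_sel bd by (intro integrable_const_bound[of _ C]) auto
    have "(\<lambda>i. LINT \<omega>|M. x (r i) \<omega>) \<longlonglongrightarrow> (LINT \<omega>|M. g \<omega>)"
    proof (rule integral_dominated_convergence[where w="\<lambda>_. C"])
      show "AE \<omega> in M. (\<lambda>i. x (r i) \<omega>) \<longlonglongrightarrow> g \<omega>"
        using AEC by eventually_elim (simp add: g_def Cauchy_convergent_iff convergent_LIMSEQ_iff)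
      show "AE \<omega> in M. norm (x (r i) \<omega>) \<le> C" for i
        using S_D(4)[OF x] by (intro AE_I2)
    qed simp_all
    moreover have "(\<lambda>i. LINT \<omega>|M. x (r i) \<omega>) \<longlonglongrightarrow> c"
    proof (rule metric_tendsto_imp_tendsto[where f="\<lambda>i. 1 / real (Suc i)"])
      show "(\<lambda>i. 1 / real (Suc i)) \<longlonglongrightarrow> 0" by (rule LIMSEQ_Suc[OF lim_1_over_n])
      have "dist (LINT \<omega>|M. x (r i) \<omega>) c \<le> 1 / real (Suc i)" for i
      proof -
        have "1 / real (Suc (r i)) \<le> 1 / real (Suc i)"
          using seq_suble[OF r, of i] by (simp add: frac_le)
        with S_D(5)[OF x, of "r i"] show ?thesis by (simp add: dist_commute)
      qed
      then show "\<forall>\<^sub>F i in sequentially. dist (LINT \<omega>|M. x (r i) \<omega>) c \<le> dist (1 / real (Suc i)) 0"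
        by (simp add: dist_real_def)
    qed
    ultimately have "(LINT \<omega>|M. g \<omega>) = c" by (rule LIMSEQ_unique)
    then show ?thesis unfolding aumann_mean_def using g_int g_sel by blast
  qed
  then show ?thesis using closure_subset_eq by blast
qed

section \<open>The weighted risk\<close>

text \<open>
The regression weights enter only through being bounded with expectation \<open>1\<close>; they may be
negative.
\<close>
locale weighted_random_set = prob_space M for M :: "'w measure" +
  fixes F :: "'w \<Rightarrow> 'a::euclidean_space set" and w :: "'w \<Rightarrow> real" and B C :: real
  assumes F_meas: "F \<in> M \<rightarrow>\<^sub>M borel_KkcB B"
    and w_meas [measurable]: "w \<in> borel_measurable M"
    and w_bound: "\<And>\<omega>. \<omega> \<in> space M \<Longrightarrow> \<bar>w \<omega>\<bar> \<le> C"
    and w_expectation: "(LINT \<omega>|M. w \<omega>) = 1"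
begin

lemma F_KkcB: "\<omega> \<in> space M \<Longrightarrow> F \<omega> \<in> KkcB B"
  using measurable_space[OF F_meas] by (simp add: space_borel_KkcB)

lemma B_nonneg: "0 \<le> B"
proof -
  obtain \<omega> where "\<omega> \<in> space M" using not_empty by blast
  then show ?thesis using KkcB_nonneg F_KkcB by blast
qed

lemma C_nonneg: "0 \<le> C"
proof -
  obtain \<omega> where "\<omega> \<in> space M" using not_empty by blast
  from w_bound[OF this] show ?thesis by simp
qed

lemma w_integrable: "integrable M w"
  using w_bound by (intro integrable_const_bound[of _ C]) auto

lemma support_measurable [measurable]: "(\<lambda>\<omega>. support_fun p (F \<omega>)) \<in> borel_measurable M"
  using measurable_compose[OF F_meas support_fun_measurable] .

lemma weighted_support_integrable: "integrable M (\<lambda>\<omega>. w \<omega> * support_fun p (F \<omega>))"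
proof (rule integrable_const_bound[of _ "C * (B * norm p)"])
  have "\<bar>w \<omega> * support_fun p (F \<omega>)\<bar> \<le> C * (B * norm p)" if "\<omega> \<in> space M" for \<omega>
    unfolding abs_mult using w_bound[OF that] support_fun_bound[OF F_KkcB[OF that], of p] C_nonneg
    by (intro mult_mono) auto
  then show "AE \<omega> in M. norm (w \<omega> * support_fun p (F \<omega>)) \<le> C * (B * norm p)"
    by (intro AE_I2) simp
qed measurable

definition weighted_mean :: "'a \<Rightarrow> real" where
  "weighted_mean p = (LINT \<omega>|M. w \<omega> * support_fun p (F \<omega>))"

lemma weighted_mean_lipschitz: "(C * B)-lipschitz_on (sphere 0 1) weighted_mean"
proof (rule lipschitz_onI)
  fix p q :: 'a
  have "dist (weighted_mean p) (weighted_mean q)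
      = \<bar>LINT \<omega>|M. w \<omega> * support_fun p (F \<omega>) - w \<omega> * support_fun q (F \<omega>)\<bar>"
    unfolding weighted_mean_def dist_real_def
    using weighted_support_integrable by simp
  also have "\<dots> \<le> (LINT \<omega>|M. C * B * dist p q)"
  proof (rule integral_abs_bound[THEN order_trans], rule integral_mono)
    show "integrable M (\<lambda>\<omega>. \<bar>w \<omega> * support_fun p (F \<omega>) - w \<omega> * support_fun q (F \<omega>)\<bar>)"
      using weighted_support_integrable by simp
    fix \<omega> assume \<omega>: "\<omega> \<in> space M"
    have "\<bar>w \<omega> * support_fun p (F \<omega>) - w \<omega> * support_fun q (F \<omega>)\<bar>
        = \<bar>w \<omega>\<bar> * \<bar>support_fun p (F \<omega>) - support_fun q (F \<omega>)\<bar>"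
      by (simp add: abs_mult flip: right_diff_distrib)
    also have "\<dots> \<le> C * (B * dist p q)"
      using w_bound[OF \<omega>] lipschitz_onD[OF support_fun_lipschitz[OF F_KkcB[OF \<omega>]], of p q] C_nonneg
      by (intro mult_mono) (auto simp: dist_real_def)
    finally show "\<bar>w \<omega> * support_fun p (F \<omega>) - w \<omega> * support_fun q (F \<omega>)\<bar> \<le> C * B * dist p q"
      by (simp add: mult.assoc)
  qed simp
  also have "\<dots> = C * B * dist p q" by (simp add: prob_space)
  finally show "dist (weighted_mean p) (weighted_mean q) \<le> C * B * dist p q" .
qed (use B_nonneg C_nonneg in simp)

lemma weighted_mean_in_L2: "weighted_mean \<in> L2_sphere"
  by (rule continuous_in_L2_sphere[OF lipschitz_on_continuous_on[OF weighted_mean_lipschitz]])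

text \<open>
A function that is Lipschitz in \<open>p\<close> is the infimum, over a countable dense set of centres \<open>q\<close>, of the
cones \<open>s(q) + B * dist q p\<close>. Each cone is jointly measurable since \<open>p\<close> and the random set occur in
separate summands. This is what makes the Fubini theorem applicable.
\<close>
lemma joint_measurable:
  "(\<lambda>(\<omega>, p). support_fun p (F \<omega>)) \<in> borel_measurable (M \<Otimes>\<^sub>M sphere_measure)"
proof -
  obtain T :: "'a set" where T: "countable T" "T \<subseteq> sphere 0 1" "sphere 0 1 \<subseteq> closure T"
    using separable[of "sphere (0::'a) 1"] by metis
  have "sphere (0::'a) 1 \<noteq> {}" by simp
  then have T_ne: "T \<noteq> {}" using T(3) by auto
  have eq: "support_fun p (F \<omega>) = (INF q\<in>T. support_fun q (F \<omega>) + B * dist q p)"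
    if \<omega>: "\<omega> \<in> space M" and p: "p \<in> sphere 0 1" for \<omega> p
  proof -
    note lip = lipschitz_onD[OF support_fun_lipschitz[OF F_KkcB[OF \<omega>]] UNIV_I UNIV_I, unfolded dist_real_def]
    have le: "support_fun p (F \<omega>) \<le> support_fun q (F \<omega>) + B * dist q p" for q
      using lip[of q p] by linarith
    show ?thesis
    proof (rule antisym)
      show "support_fun p (F \<omega>) \<le> (INF q\<in>T. support_fun q (F \<omega>) + B * dist q p)"
        using T_ne le by (intro cINF_greatest)
      show "(INF q\<in>T. support_fun q (F \<omega>) + B * dist q p) \<le> support_fun p (F \<omega>)"
      proof (rule field_le_epsilon)
        fix e :: real assume e: "0 < e"
        then have "0 < e / (2 * B + 1)" using B_nonneg by simp
        moreover have "p \<in> closure T" using p T(3) by blast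
        ultimately obtain q where q: "q \<in> T" "dist q p < e / (2 * B + 1)"
          unfolding closure_approachable by blast
        have "bdd_below ((\<lambda>q. support_fun q (F \<omega>) + B * dist q p) ` T)"
          using le by (intro bdd_belowI[of _ "support_fun p (F \<omega>)"]) auto
        from cINF_lower[OF this q(1)]
        have "(INF q\<in>T. support_fun q (F \<omega>) + B * dist q p) \<le> support_fun q (F \<omega>) + B * dist q p" .
        also have "\<dots> \<le> support_fun p (F \<omega>) + 2 * B * dist q p"
          using lip[of q p] by linarith
        also have "2 * B * dist q p \<le> (2 * B + 1) * (e / (2 * B + 1))"
          using q(2) B_nonneg by (intro mult_mono) auto
        also have "\<dots> = e" using B_nonneg by simp
        finally show "(INF q\<in>T. support_fun q (F \<omega>) + B * dist q p) \<le> support_fun p (F \<omega>) + e"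
          by simp
      qed
    qed
  qed
  have dist_meas [measurable]: "(\<lambda>p. dist q p) \<in> borel_measurable sphere_measure" for q :: 'a
    by (intro continuous_on_sphere_measurable continuous_intros)
  have "(\<lambda>z. INF q\<in>T. support_fun q (F (fst z)) + B * dist q (snd z))
      \<in> borel_measurable (M \<Otimes>\<^sub>M sphere_measure)"
    using T(1) by measurable
  then show ?thesis
    by (rule measurable_cong[THEN iffD1, rotated])
      (auto simp: space_pair_measure space_sphere_measure eq)
qed

lemma pair_sphere: "pair_sigma_finite M (sphere_measure :: 'a measure)"
  by (intro pair_sigma_finite.intro sigma_finite_measure_axioms sphere.sigma_finite_measure_axioms)

lemma integrable_pair_dominated:
  fixes k :: "'w \<times> 'a \<Rightarrow> real"
  assumes k: "k \<in> borel_measurable (M \<Otimes>\<^sub>M sphere_measure)"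
    and K: "integrable sphere_measure K"
    and le: "\<And>\<omega> p. \<omega> \<in> space M \<Longrightarrow> p \<in> sphere 0 1 \<Longrightarrow> \<bar>k (\<omega>, p)\<bar> \<le> K p"
  shows "integrable (M \<Otimes>\<^sub>M sphere_measure) k"
proof (rule Bochner_Integration.integrable_bound)
  interpret pair_sigma_finite M "sphere_measure :: 'a measure" by (rule pair_sphere)
  have [measurable]: "K \<in> borel_measurable sphere_measure" using K by auto
  show "integrable (M \<Otimes>\<^sub>M sphere_measure) (\<lambda>z. K (snd z))"
    by (rule Fubini_integrable) (use K in auto)
  show "AE z in M \<Otimes>\<^sub>M sphere_measure. norm (k z) \<le> norm (K (snd z))"
    using le by (intro AE_I2) (fastforce simp: space_pair_measure space_sphere_measure)
qed (rule k)

lemma weighted_product_integrable: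
  assumes h: "h \<in> L2_sphere"
  shows "integrable (M \<Otimes>\<^sub>M sphere_measure) (\<lambda>(\<omega>, p). w \<omega> * (h p * support_fun p (F \<omega>)))"
proof (rule integrable_pair_dominated[where K="\<lambda>p. C * (\<bar>h p\<bar> * B)"])
  have [measurable]: "h \<in> borel_measurable sphere_measure" using h by (rule L2_sphere_D(1))
  note joint_measurable[measurable]
  show "(\<lambda>(\<omega>, p). w \<omega> * (h p * support_fun p (F \<omega>))) \<in> borel_measurable (M \<Otimes>\<^sub>M sphere_measure)"
    by measurable
  have "integrable sphere_measure (\<lambda>p. h p * 1)"
    by (intro L2_mult_integrable h continuous_in_L2_sphere continuous_intros)
  then show "integrable sphere_measure (\<lambda>p. C * (\<bar>h p\<bar> * B))" by simp
  fix \<omega> p assume "\<omega> \<in> space M" "p \<in> sphere (0::'a) 1"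
  then show "\<bar>case (\<omega>, p) of (\<omega>, p) \<Rightarrow> w \<omega> * (h p * support_fun p (F \<omega>))\<bar> \<le> C * (\<bar>h p\<bar> * B)"
    using w_bound[of \<omega>] support_fun_bound[OF F_KkcB, of \<omega> p] C_nonneg
    by (auto simp: abs_mult intro!: mult_mono)
qed

lemma weighted_square_integrable:
  "integrable (M \<Otimes>\<^sub>M sphere_measure) (\<lambda>(\<omega>, p). w \<omega> * (support_fun p (F \<omega>))\<^sup>2)"
proof (rule integrable_pair_dominated[where K="\<lambda>p. C * B\<^sup>2"])
  note joint_measurable[measurable]
  show "(\<lambda>(\<omega>, p). w \<omega> * (support_fun p (F \<omega>))\<^sup>2) \<in> borel_measurable (M \<Otimes>\<^sub>M sphere_measure)"
    by measurable
  fix \<omega> p assume *: "\<omega> \<in> space M" "p \<in> sphere (0::'a) 1"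
  then have "(support_fun p (F \<omega>))\<^sup>2 \<le> B\<^sup>2"
    using support_fun_bound[OF F_KkcB, of \<omega> p] B_nonneg by (simp add: abs_le_square_iff[symmetric])
  then show "\<bar>case (\<omega>, p) of (\<omega>, p) \<Rightarrow> w \<omega> * (support_fun p (F \<omega>))\<^sup>2\<bar> \<le> C * B\<^sup>2"
    using w_bound[of \<omega>] * C_nonneg by (auto simp: abs_mult intro!: mult_mono)
qed simp

definition weighted_risk :: "('a \<Rightarrow> real) \<Rightarrow> real" where
  "weighted_risk h = (LINT \<omega>|M. w \<omega> * (norm_L2 (\<lambda>p. h p - Psi (F \<omega>) p))\<^sup>2)"

text \<open>
Expand the square. The term \<open>E [w] * \<parallel>h\<parallel>\<^sup>2\<close> is \<open>\<parallel>h\<parallel>\<^sup>2\<close>, the mixed term becomes the inner product of \<open>h\<close>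
with the weighted mean by the Fubini theorem, and the last term does not contain \<open>h\<close>. Hence the
functional is a shifted squared distance even for weights of varying sign.
\<close>
lemma weighted_risk_decomposition:
  assumes h: "h \<in> L2_sphere"
  shows "weighted_risk h = (norm_L2 (\<lambda>p. h p - weighted_mean p))\<^sup>2 + weighted_risk weighted_mean"
proof -
  interpret pair_sigma_finite M "sphere_measure :: 'a measure" by (rule pair_sphere)
  define K where "K = (LINT \<omega>|M. LINT p|sphere_measure. w \<omega> * (support_fun p (F \<omega>))\<^sup>2)"
  have expand: "weighted_risk u = (norm_L2 u)\<^sup>2
      - 2 * (LINT p|sphere_measure. u p * weighted_mean p) + K" if u: "u \<in> L2_sphere" for u
  proof -
    have "weighted_risk u = (LINT \<omega>|M. w \<omega> * (norm_L2 u)\<^sup>2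
        - 2 * (LINT p|sphere_measure. w \<omega> * (u p * support_fun p (F \<omega>)))
        + (LINT p|sphere_measure. w \<omega> * (support_fun p (F \<omega>))\<^sup>2))"
      unfolding weighted_risk_def
    proof (rule Bochner_Integration.integral_cong[OF refl])
      fix \<omega> assume "\<omega> \<in> space M"
      note PF = Psi_in_L2[OF F_KkcB[OF this]]
      have 1: "(LINT p|sphere_measure. u p * Psi (F \<omega>) p) = (LINT p|sphere_measure. u p * support_fun p (F \<omega>))"
        and 2: "(LINT p|sphere_measure. (Psi (F \<omega>) p)\<^sup>2) = (LINT p|sphere_measure. (support_fun p (F \<omega>))\<^sup>2)"
        by (auto simp: space_sphere_measure intro!: Bochner_Integration.integral_cong)
      have "(norm_L2 (\<lambda>p. u p - Psi (F \<omega>) p))\<^sup>2 = (norm_L2 u)\<^sup>2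
          - 2 * (LINT p|sphere_measure. u p * support_fun p (F \<omega>))
          + (LINT p|sphere_measure. (support_fun p (F \<omega>))\<^sup>2)"
        using L2_lincomb(2)[OF u PF, of 1 "-1"] unfolding norm_L2_square 1 2 by simp
      then show "w \<omega> * (norm_L2 (\<lambda>p. u p - Psi (F \<omega>) p))\<^sup>2 = w \<omega> * (norm_L2 u)\<^sup>2
        - 2 * (LINT p|sphere_measure. w \<omega> * (u p * support_fun p (F \<omega>)))
        + (LINT p|sphere_measure. w \<omega> * (support_fun p (F \<omega>))\<^sup>2)"
        by (simp add: ring_distribs)
    qed
    also have "\<dots> = (norm_L2 u)\<^sup>2
        - 2 * (LINT \<omega>|M. LINT p|sphere_measure. w \<omega> * (u p * support_fun p (F \<omega>))) + K"
      unfolding K_def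
      using w_integrable integrable_fst[OF weighted_product_integrable[OF u]]
        integrable_fst[OF weighted_square_integrable]
      by (simp add: w_expectation)
    also have "(LINT \<omega>|M. LINT p|sphere_measure. w \<omega> * (u p * support_fun p (F \<omega>)))
        = (LINT p|sphere_measure. LINT \<omega>|M. w \<omega> * (u p * support_fun p (F \<omega>)))"
      by (rule Fubini_integral[symmetric]) (rule weighted_product_integrable[OF u])
    also have "\<dots> = (LINT p|sphere_measure. u p * weighted_mean p)"
      by (simp add: weighted_mean_def mult.left_commute)
    finally show ?thesis .
  qed
  have "(norm_L2 (\<lambda>p. h p - weighted_mean p))\<^sup>2 = (norm_L2 h)\<^sup>2
      - 2 * (LINT p|sphere_measure. h p * weighted_mean p) + (norm_L2 weighted_mean)\<^sup>2"
    using L2_lincomb(2)[OF h weighted_mean_in_L2, of 1 "-1"] unfolding norm_L2_square by simp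
  moreover have "(LINT p|sphere_measure. weighted_mean p * weighted_mean p) = (norm_L2 weighted_mean)\<^sup>2"
    unfolding norm_L2_square by (simp add: power2_eq_square)
  ultimately show ?thesis
    using expand[OF h] expand[OF weighted_mean_in_L2] by simp
qed

end

lemma (in weighted_random_set) weighted_risk_minimizers:
  "is_arg_min weighted_risk (\<lambda>h. h \<in> L2_sphere) h \<longleftrightarrow>
    h \<in> L2_sphere \<and> (AE p in sphere_measure. h p = weighted_mean p)"
proof -
  have "is_arg_min weighted_risk (\<lambda>h. h \<in> L2_sphere) h \<longleftrightarrow>
      h \<in> L2_sphere \<and> norm_L2 (\<lambda>p. h p - weighted_mean p) = 0"
  proof (cases "h \<in> L2_sphere")
    case True
    have "(\<exists>k. k \<in> L2_sphere \<and> weighted_risk k < weighted_risk h) \<longleftrightarrow>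
        norm_L2 (\<lambda>p. h p - weighted_mean p) \<noteq> 0"
    proof
      assume "\<exists>k. k \<in> L2_sphere \<and> weighted_risk k < weighted_risk h"
      then obtain k where k: "k \<in> L2_sphere" "weighted_risk k < weighted_risk h" by blast
      show "norm_L2 (\<lambda>p. h p - weighted_mean p) \<noteq> 0"
        using k(2) zero_le_power2[of "norm_L2 (\<lambda>p. k p - weighted_mean p)"]
        unfolding weighted_risk_decomposition[OF True] weighted_risk_decomposition[OF k(1)]
        by auto
    next
      assume "norm_L2 (\<lambda>p. h p - weighted_mean p) \<noteq> 0"
      then have "weighted_risk weighted_mean < weighted_risk h"
        unfolding weighted_risk_decomposition[OF True] by simp
      then show "\<exists>k. k \<in> L2_sphere \<and> weighted_risk k < weighted_risk h"
        using weighted_mean_in_L2 by blast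
    qed
    with True show ?thesis unfolding is_arg_min_def by blast
  qed (simp add: is_arg_min_def)
  moreover have "norm_L2 (\<lambda>p. h p - weighted_mean p) = 0 \<longleftrightarrow>
      (AE p in sphere_measure. h p = weighted_mean p)" if "h \<in> L2_sphere"
    using norm_L2_eq_0_iff[OF L2_diff[OF that weighted_mean_in_L2]] by simp
  ultimately show ?thesis by blast
qed

section \<open>Inclusion in the Aumann mean\<close>

text \<open>
The means of the selections \<open>w *\<^sub>R closest_point F (t *\<^sub>R p)\<close> show that the support function of the Aumann
mean dominates the weighted mean of the support functions. A negative weight only helps: then
\<open>w * (p \<bullet> f) \<ge> w * support_fun p F\<close> for every \<open>f\<close> in \<open>F\<close>. The inequality can be strict, which is why
one gets inclusion and not equality.
\<close>
lemma (in weighted_random_set) subset_aumann_mean: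
  assumes G: "G \<in> Kkc" and le: "\<And>p. p \<in> sphere 0 1 \<Longrightarrow> support_fun p G \<le> weighted_mean p"
  shows "G \<subseteq> aumann_mean M (\<lambda>\<omega>. (*\<^sub>R) (w \<omega>) ` F \<omega>)"
proof
  let ?A = "aumann_mean M (\<lambda>\<omega>. (*\<^sub>R) (w \<omega>) ` F \<omega>)"
  let ?sel = "\<lambda>q \<omega>. w \<omega> *\<^sub>R closest_point (F \<omega>) q"
  have cp_in: "closest_point (F \<omega>) q \<in> F \<omega>" if "\<omega> \<in> space M" for \<omega> q
    using closest_point_in_set KkcB_D(1,4) F_KkcB[OF that] by metis
  have bound: "norm f \<le> C * B" if "\<omega> \<in> space M" "f \<in> (*\<^sub>R) (w \<omega>) ` F \<omega>" for \<omega> f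
    using that w_bound[OF that(1)] KkcB_D(5)[OF F_KkcB[OF that(1)]] C_nonneg
    by (auto intro!: mult_mono)
  have cp_meas [measurable]: "(\<lambda>\<omega>. closest_point (F \<omega>) q) \<in> borel_measurable M" for q
    using measurable_compose[OF F_meas closest_point_measurable] .
  have sel_int: "integrable M (?sel q)" for q
    using bound[OF _ imageI[OF cp_in]] by (intro integrable_const_bound[of _ "C * B"] AE_I2) measurable
  have sel_in: "(LINT \<omega>|M. ?sel q \<omega>) \<in> ?A" for q
    unfolding aumann_mean_def using sel_int[of q] cp_in by blast
  fix g assume g: "g \<in> G"
  show "g \<in> ?A"
  proof (rule mem_closed_convex_by_halfspaces)
    show "closed ?A"
      using bound
      by (intro aumann_mean_closed[where C="C * B"] compact_imp_closed compact_scaling convex_scaling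
          KkcB_D(2,3)[OF F_KkcB])
    show "convex ?A"
      by (intro aumann_mean_convex convex_scaling KkcB_D(3)[OF F_KkcB])
    show "?A \<noteq> {}" using sel_in by blast
    fix p :: 'a and c assume p: "norm p = 1" and c: "\<And>y. y \<in> ?A \<Longrightarrow> p \<bullet> y \<le> c"
    have near: "weighted_mean p - C * B\<^sup>2 / (2 * t) \<le> c" if t: "0 < t" for t
    proof -
      have "weighted_mean p - C * B\<^sup>2 / (2 * t)
          = (LINT \<omega>|M. w \<omega> * support_fun p (F \<omega>) - C * B\<^sup>2 / (2 * t))"
        unfolding weighted_mean_def using weighted_support_integrable by (simp add: prob_space)
      also have "\<dots> \<le> (LINT \<omega>|M. p \<bullet> ?sel (t *\<^sub>R p) \<omega>)"
      proof (rule integral_mono)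
        fix \<omega> assume \<omega>: "\<omega> \<in> space M"
        let ?f = "closest_point (F \<omega>) (t *\<^sub>R p)"
        obtain f where f: "f \<in> F \<omega>" "support_fun p (F \<omega>) = p \<bullet> f"
          using support_fun_attained KkcB_D(1,2) F_KkcB[OF \<omega>] by metis
        have lo: "support_fun p (F \<omega>) - B\<^sup>2 / (2 * t) \<le> p \<bullet> ?f"
          using closest_point_nearly_maximizes[OF F_KkcB[OF \<omega>] f(1) t, of p] f(2) by simp
        have up: "p \<bullet> ?f \<le> support_fun p (F \<omega>)"
          using support_fun_upper[OF KkcB_D(2)[OF F_KkcB[OF \<omega>]] cp_in[OF \<omega>]] .
        have nn: "0 \<le> B\<^sup>2 / (2 * t)" using t by simp
        have "w \<omega> * support_fun p (F \<omega>) - C * (B\<^sup>2 / (2 * t)) \<le> w \<omega> * (p \<bullet> ?f)"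
        proof (cases "0 \<le> w \<omega>")
          case True
          have "w \<omega> * (support_fun p (F \<omega>) - B\<^sup>2 / (2 * t)) \<le> w \<omega> * (p \<bullet> ?f)"
            using lo True by (rule mult_left_mono)
          moreover have "w \<omega> * (B\<^sup>2 / (2 * t)) \<le> C * (B\<^sup>2 / (2 * t))"
            using w_bound[OF \<omega>] nn by (intro mult_right_mono) auto
          ultimately show ?thesis by (simp add: right_diff_distrib)
        next
          case False
          then have "w \<omega> * support_fun p (F \<omega>) \<le> w \<omega> * (p \<bullet> ?f)"
            using up by (intro mult_left_mono_neg) auto
          moreover have "0 \<le> C * (B\<^sup>2 / (2 * t))" using C_nonneg nn by (intro mult_nonneg_nonneg)
          ultimately show ?thesis by linarith
        qed
        then show "w \<omega> * support_fun p (F \<omega>) - C * B\<^sup>2 / (2 * t) \<le> p \<bullet> ?sel (t *\<^sub>R p) \<omega>"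
          by simp
      qed (intro Bochner_Integration.integrable_diff weighted_support_integrable integrable_const
          integrable_inner_right sel_int)+
      also have "\<dots> = p \<bullet> (LINT \<omega>|M. ?sel (t *\<^sub>R p) \<omega>)"
        using sel_int by (rule integral_inner_right)
      also have "\<dots> \<le> c" using sel_in by (rule c)
      finally show ?thesis .
    qed
    have "(\<lambda>n. weighted_mean p - C * B\<^sup>2 / 2 * (1 / real (Suc n))) \<longlonglongrightarrow> weighted_mean p - C * B\<^sup>2 / 2 * 0"
      by (intro tendsto_intros LIMSEQ_Suc[OF lim_1_over_n])
    then have "weighted_mean p - C * B\<^sup>2 / 2 * 0 \<le> c"
      by (rule LIMSEQ_le_const2) (use near[of "real (Suc _)"] in \<open>auto simp del: of_nat_Suc\<close>)
    then show "p \<bullet> g \<le> c"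
      using support_fun_upper[OF Kkc_D(2)[OF G] g, of p] le[of p] p by simp
  qed
qed

section \<open>Global Frechet regression\<close>

lemma unique_is_arg_min:
  fixes f :: "'b \<Rightarrow> real"
  assumes "P a" "\<And>b. P b \<Longrightarrow> b \<noteq> a \<Longrightarrow> f a < f b"
  shows "is_arg_min f P b \<longleftrightarrow> b = a"
  unfolding is_arg_min_def using assms by (metis less_asym)

text \<open>
Only the affine form of the weight matters: centring makes its expectation \<open>1\<close>, and on a compact
set it is bounded.
\<close>
lemma weight_affine:
  obtains a where "\<And>z. weight M X x z = 1 + a \<bullet> (z - mean_vec M X)"
proof
  show "weight M X x z = 1 + ((x - mean_vec M X) v* matrix_inv (cov_mat M X)) \<bullet> (z - mean_vec M X)" for z
    by (simp add: weight_def dot_lmul_matrix)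
qed

lemma weighted_random_set_weight:
  fixes X :: "'w \<Rightarrow> real^'p" and F :: "'w \<Rightarrow> 'a::euclidean_space set"
  assumes "prob_space M" "compact K" "F \<in> M \<rightarrow>\<^sub>M borel_KkcB B" "X \<in> M \<rightarrow>\<^sub>M restrict_space borel K"
  obtains C where "weighted_random_set M F (\<lambda>\<omega>. weight M X x (X \<omega>)) B C"
proof -
  interpret prob_space M by fact
  obtain a where a: "\<And>z. weight M X x z = 1 + a \<bullet> (z - mean_vec M X)"
    using weight_affine by metis
  have X_meas [measurable]: "X \<in> borel_measurable M" and X_in: "\<And>\<omega>. \<omega> \<in> space M \<Longrightarrow> X \<omega> \<in> K"
    using assms(4) by (auto simp: measurable_restrict_space2_iff)
  obtain R where R: "\<And>z. z \<in> K \<Longrightarrow> norm z \<le> R"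
    using compact_imp_bounded[OF assms(2)] unfolding bounded_iff by blast
  have X_int: "integrable M X"
    using X_in R by (intro integrable_const_bound[of _ R] AE_I2) auto
  have "bounded (weight M X x ` K)"
    unfolding a by (intro compact_imp_bounded compact_continuous_image continuous_intros assms(2))
  then obtain C where C: "\<And>z. z \<in> K \<Longrightarrow> \<bar>weight M X x z\<bar> \<le> C"
    unfolding bounded_iff by auto
  have "weighted_random_set M F (\<lambda>\<omega>. weight M X x (X \<omega>)) B C"
  proof
    show "(LINT \<omega>|M. weight M X x (X \<omega>)) = 1"
      unfolding a using X_int by (simp add: prob_space mean_vec_def)
    show "(\<lambda>\<omega>. weight M X x (X \<omega>)) \<in> borel_measurable M"
      unfolding a by measurable
  qed (use assms(3) C X_in in auto)
  then show ?thesis by (rule that)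
qed

theorem proposition3p1:
  fixes M :: "'w measure"
    and F :: "'w \<Rightarrow> (real^'d) set"
    and X :: "'w \<Rightarrow> real^'p"
    and \<X> :: "(real^'p) set"
    and B :: real
    and x :: "real^'p"
  assumes "prob_space M"
    and "B > 0"
    and "compact \<X>"
    and "F \<in> M \<rightarrow>\<^sub>M borel_KkcB B"
    and "X \<in> M \<rightarrow>\<^sub>M restrict_space borel \<X>"
    and "invertible (cov_mat M X)"
  shows "(L2_mean M F X x \<in> L2_sphere \<and>
          (\<forall>h. is_arg_min (L2_risk M F X x) (\<lambda>h. h \<in> L2_sphere) h \<longleftrightarrow>
            h \<in> L2_sphere \<and> (AE p in sphere_measure. h p = L2_mean M F X x p))) \<and>
         (\<forall>h. is_arg_min (\<lambda>h. norm_L2 (\<lambda>p. h p - m_Psi M F X x p)) (\<lambda>h. h \<in> Psi ` KkcB B) h \<longleftrightarrow>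
            h = m_tilde M B F X x) \<and>
         (\<forall>\<nu>. is_arg_min (\<lambda>\<nu>. LINT \<omega>|M. weight M X x (X \<omega>) * (d_kc \<nu> (F \<omega>))\<^sup>2)
                (\<lambda>\<nu>. \<nu> \<in> KkcB B) \<nu> \<longleftrightarrow>
            \<nu> = m_plus M B F X x) \<and>
         (bdd_above ((\<lambda>z. \<bar>weight M X x z\<bar>) ` \<X>) \<longrightarrow>
            (\<forall>G\<in>Kkc. (AE p in sphere_measure. m_Psi M F X x p = Psi G p) \<longrightarrow>
               G \<subseteq> aumann_mean M (\<lambda>\<omega>. (*\<^sub>R) (weight M X x (X \<omega>)) ` F \<omega>)) \<and>
            ((\<exists>G\<in>KkcB B. AE p in sphere_measure. m_Psi M F X x p = Psi G p) \<longrightarrow>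
               m_plus M B F X x \<subseteq> aumann_mean M (\<lambda>\<omega>. (*\<^sub>R) (weight M X x (X \<omega>)) ` F \<omega>)))"
proof -
  define w where "w = (\<lambda>\<omega>. weight M X x (X \<omega>))"
  obtain C where "weighted_random_set M F w B C"
    unfolding w_def by (rule weighted_random_set_weight[OF assms(1,3,4,5)])
  then interpret weighted_random_set M F w B C .
  have w: "weight M X x (X \<omega>) = w \<omega>" for \<omega>
    by (simp add: w_def)
  let ?m = "m_Psi M F X x"
  have risk: "L2_risk M F X x = weighted_risk"
    by (simp add: fun_eq_iff L2_risk_def weighted_risk_def w)
  have mean: "L2_mean M F X x p = weighted_mean p" if "p \<in> sphere 0 1" for p
    using that by (simp add: L2_mean_def weighted_mean_def w)
  have mean_L2: "L2_mean M F X x \<in> L2_sphere"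
    using lipschitz_on_continuous_on[OF weighted_mean_lipschitz] mean
    by (intro continuous_in_L2_sphere) (metis (no_types, lifting) continuous_on_cong)
  have AE_mean: "(AE p in sphere_measure. h p = L2_mean M F X x p) \<longleftrightarrow>
      (AE p in sphere_measure. h p = weighted_mean p)" for h
    by (intro AE_cong) (simp add: mean space_sphere_measure)
  have part1: "L2_mean M F X x \<in> L2_sphere \<and>
      (\<forall>h. is_arg_min (L2_risk M F X x) (\<lambda>h. h \<in> L2_sphere) h \<longleftrightarrow>
        h \<in> L2_sphere \<and> (AE p in sphere_measure. h p = L2_mean M F X x p))"
    unfolding risk AE_mean using mean_L2 weighted_risk_minimizers by blast

  have "is_arg_min weighted_risk (\<lambda>h. h \<in> L2_sphere) ?m"
    unfolding m_Psi_def arg_min_on_def arg_min_def risk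
    by (rule someI[of _ weighted_mean]) (simp add: weighted_risk_minimizers weighted_mean_in_L2)
  then have m_L2: "?m \<in> L2_sphere" and m_AE: "AE p in sphere_measure. ?m p = weighted_mean p"
    by (simp_all add: weighted_risk_minimizers)

  obtain G where G: "G \<in> KkcB B"
    and G_min: "\<And>H. H \<in> KkcB B \<Longrightarrow> H \<noteq> G \<Longrightarrow>
      norm_L2 (\<lambda>p. Psi G p - ?m p) < norm_L2 (\<lambda>p. Psi H p - ?m p)"
    by (rule closed_convex_projection[OF m_L2 less_imp_le[OF assms(2)]]) blast
  have proj: "is_arg_min (\<lambda>h. norm_L2 (\<lambda>p. h p - ?m p)) (\<lambda>h. h \<in> Psi ` KkcB B) h \<longleftrightarrow> h = Psi G" for h
    using G G_min by (intro unique_is_arg_min) auto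
  then have tilde: "m_tilde M B F X x = Psi G"
    by (simp add: m_tilde_def arg_min_on_def arg_min_def)
  have plus: "m_plus M B F X x = G"
    unfolding m_plus_def tilde by (rule inv_into_f_f[OF inj_on_Psi G])

  \<comment> \<open>The representative chosen for \<open>m_Psi\<close> is irrelevant for distances.\<close>
  have m_dist: "norm_L2 (\<lambda>p. h p - weighted_mean p) = norm_L2 (\<lambda>p. h p - ?m p)" if "h \<in> L2_sphere" for h
    using L2_diff[OF that m_L2] L2_diff[OF that weighted_mean_in_L2] m_AE
    by (intro norm_L2_cong_AE L2_sphere_D(1)) auto
  have frechet: "(LINT \<omega>|M. weight M X x (X \<omega>) * (d_kc \<nu> (F \<omega>))\<^sup>2) =
      (norm_L2 (\<lambda>p. Psi \<nu> p - ?m p))\<^sup>2 + weighted_risk weighted_mean" if "\<nu> \<in> KkcB B" for \<nu>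
    using weighted_risk_decomposition[OF Psi_in_L2[OF that]] m_dist[OF Psi_in_L2[OF that]]
    by (simp add: weighted_risk_def d_kc_def w)
  have part3: "is_arg_min (\<lambda>\<nu>. LINT \<omega>|M. weight M X x (X \<omega>) * (d_kc \<nu> (F \<omega>))\<^sup>2)
      (\<lambda>\<nu>. \<nu> \<in> KkcB B) \<nu> \<longleftrightarrow> \<nu> = G" for \<nu>
    by (rule unique_is_arg_min) (auto simp: G frechet intro!: power_strict_mono G_min)

  have contained: "H \<subseteq> aumann_mean M (\<lambda>\<omega>. (*\<^sub>R) (weight M X x (X \<omega>)) ` F \<omega>)"
    if H: "H \<in> Kkc" and ae: "AE p in sphere_measure. ?m p = Psi H p" for H
  proof -
    obtain B' where H': "H \<in> KkcB B'" using Kkc_in_KkcB[OF H] by blast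
    have "AE p in sphere_measure. Psi H p = weighted_mean p"
      using ae m_AE by eventually_elim simp
    from lipschitz_AE_eq_imp_eq[OF Psi_lipschitz[OF H'] weighted_mean_lipschitz this]
    have "support_fun p H = weighted_mean p" if "p \<in> sphere 0 1" for p
      using that by auto
    then show ?thesis
      using subset_aumann_mean[OF H] by (simp add: w)
  qed
  have inside: "G \<subseteq> aumann_mean M (\<lambda>\<omega>. (*\<^sub>R) (weight M X x (X \<omega>)) ` F \<omega>)"
    if H: "H \<in> KkcB B" and ae: "AE p in sphere_measure. ?m p = Psi H p" for H
  proof -
    have "AE p in sphere_measure. Psi H p - ?m p = 0"
      using ae by eventually_elim simp
    then have "norm_L2 (\<lambda>p. Psi H p - ?m p) = 0"
      using norm_L2_eq_0_iff[OF L2_diff[OF Psi_in_L2[OF H] m_L2]] by blast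
    then have "H = G"
      using G_min[OF H] norm_L2_nonneg[of "\<lambda>p. Psi G p - ?m p"] by linarith
    then show ?thesis
      using contained[of G] ae G by (simp add: KkcB_iff)
  qed
  show ?thesis
    unfolding plus tilde using part1 proj part3 contained inside by blast
qed

end
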